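(* Let $f(t)=f_0(t)+f_1(t)\cos\theta(t)$, $t\in[0,1]$, be a signal that is periodic over $[0,1]$, with $f_1(t)>0$ and $\theta'(t)>0$ on $[0,1]$. Put $L=\frac{\theta(1)-\theta(0)}{2\pi}$ and $\bar\theta=\frac{\theta-\theta(0)}{2\pi L}$. Assume that the instantaneous frequency has a sparse representation, i.e. there exists $M_0$ such that $\theta'\in V_{M_0}$, and that the Fourier coefficients of the local mean $f_0$ and the envelope $f_1$ in the $\bar\theta$-space have a fast decay, i.e. there exist $C_0>0$ and $p\ge 4$ such that $$|\widehat f_{0,\theta}(k)|\le C_0|k|^{-p},\qquad |\widehat f_{1,\theta}(k)|\le C_0|k|^{-p}\qquad (k\ne 0).$$ Let $(\theta^m)_{m\ge 0}$ be the phase functions generated from the initial guess $\theta^0$ by the iteration described in the context. Then there exists $\eta_0>4$ such that if $L>\eta_0$ and the initial guess satisfies $$\|\mathcal F((\theta^0-\theta)')\|_1\le \pi M_0/2,$$ then $$\|\mathcal F((\theta^{m+1}-\theta)')\|_1\le \Gamma_0 (L/4)^{-p+2}+\tfrac12\,\|\mathcal F((\theta^{m}-\theta)')\|_1\qquad (m=0,1,2,\dots),$$ where $\Gamma_0>0$ is a constant determined by $C_0$, $p$, $M_0$ and $f_1$.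
   Context: Notation. For a function $g$ on $[0,1]$, $\mathcal F(g)(k)=\int_0^1 g(t)e^{-i2\pi kt}\,dt$, $k\in\mathbb Z$, and $\|\cdot\|_1$ of a coefficient sequence is its $\ell^1$ norm. $V_{M_0}=\mathrm{span}\{e^{i2\pi kt}: k=-M_0,\dots,M_0\}$ and $P_{V_{M_0}}$ is the projection onto $V_{M_0}$. For an increasing phase function $\phi$ on $[0,1]$ put $L_\phi=\frac{\phi(1)-\phi(0)}{2\pi}$, $\bar\phi=\frac{\phi-\phi(0)}{2\pi L_\phi}$, and for a function $g$ on $[0,1]$ let $\widehat g_{\phi}(k)=\int_0^1 g\,e^{-i2\pi k\bar\phi}\,d\bar\phi$. $\widehat f_{0,\theta}$ and $\widehat f_{1,\theta}$ denote $\widehat{(f_0)}_\theta$ and $\widehat{(f_1)}_\theta$. $L$ is the number of periods of the signal. Iteration (the signal is known for all $t\in[0,1]$ and Fourier transforms in the $\theta^m$-coordinate are exact). Given $\theta^m$, write $L^m=L_{\theta^m}$, let $\chi(x)=1$ for $-1/2<x<1/2$ and $\chi(x)=0$ otherwise, and set $$a(t)=\sum_{\omega\in\mathbb Z}\big(\widehat f_{\theta^m}(\omega+L^m)+\widehat f_{\theta^m}(\omega-L^m)\big)\chi(\omega/L^m)\,e^{i2\pi\omega\bar\theta^m(t)},$$ $$b(t)=\sum_{\omega\in\mathbb Z}(-i)\big(\widehat f_{\theta^m}(\omega+L^m)-\widehat f_{\theta^m}(\omega-L^m)\big)\chi(\omega/L^m)\,e^{i2\pi\omega\bar\theta^m(t)}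 .$$ Then $\Delta\theta'=P_{V_{M_0}}\big(\frac{d}{dt}\arctan(b/a)\big)$, $\Delta\theta(t)=\int_0^t\Delta\theta'(s)\,ds$, and $\theta^{m+1}=\theta^m+\beta\Delta\theta$ with $\beta=\max\{\alpha\in[0,1]:\frac{d}{dt}(\theta^m+\alpha\Delta\theta)\ge 0\}$.
   Formalization: Added: (θ^0)' ∈ V_{M_0} and L_{θ^0} an integer; otherwise a frequency above M_0 or a fractional mean error is never reduced and the bound fails for large L. Also f_0, f_1 are continuous, L is an integer, and η_0 may depend on C_0, p, M_0, f_1 and θ̄. *)

theory Defs
  imports "HOL-Analysis.Analysis"
begin

text \<open>Functions on the unit interval are total functions on the reals of which only the values
  on \<open>{0..1}\<close> matter; derivatives are taken within \<open>{0..1}\<close>, hence one-sided at the endpoints.\<close>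

definition deriv01 :: "(real \<Rightarrow> real) \<Rightarrow> real \<Rightarrow> real" where
  "deriv01 g t = vector_derivative g (at t within {0..1})"

definition expi :: "real \<Rightarrow> complex" where
  "expi x = exp (\<i> * complex_of_real (2 * pi * x))"

definition fourier :: "(real \<Rightarrow> real) \<Rightarrow> int \<Rightarrow> complex" where
  "fourier g k = integral {0..1} (\<lambda>t. complex_of_real (g t) * expi (- (real_of_int k * t)))"

text \<open>The value is extended: a sequence that is not summable has norm \<open>\<infinity>\<close>, not 0.\<close>

definition l1_norm :: "(int \<Rightarrow> complex) \<Rightarrow> ennreal" where
  "l1_norm c = (\<Sum>\<^sub>\<infinity>k\<in>UNIV. ennreal (norm (c k)))"

definition trig_space :: "nat \<Rightarrow> (real \<Rightarrow> complex) set" where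
  "trig_space M = {g. \<exists>c :: int \<Rightarrow> complex.
     g = (\<lambda>t. \<Sum>k\<in>{- int M..int M}. c k * expi (real_of_int k * t))}"

definition has_deriv_in_trig_space :: "nat \<Rightarrow> (real \<Rightarrow> real) \<Rightarrow> bool" where
  "has_deriv_in_trig_space M \<phi> \<longleftrightarrow>
     (\<exists>g\<in>trig_space M. \<forall>t\<in>{0..1}.
        ((\<lambda>s. complex_of_real (\<phi> s)) has_vector_derivative g t) (at t within {0..1}))"

text \<open>Orthogonal projection in the space of square-integrable functions on \<open>{0..1}\<close>, for which
  the exponentials are orthonormal. For a real function the sum below is real.\<close>

definition proj_trig :: "nat \<Rightarrow> (real \<Rightarrow> real) \<Rightarrow> real \<Rightarrow> real" where
  "proj_trig M g t = Re (\<Sum>k\<in>{- int M..int M}. fourier g k * expi (real_of_int k * t))"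

definition num_periods :: "(real \<Rightarrow> real) \<Rightarrow> real" where
  "num_periods \<phi> = (\<phi> 1 - \<phi> 0) / (2 * pi)"

definition norm_phase :: "(real \<Rightarrow> real) \<Rightarrow> real \<Rightarrow> real" where
  "norm_phase \<phi> t = (\<phi> t - \<phi> 0) / (2 * pi * num_periods \<phi>)"

text \<open>The integral with respect to the normalised phase is written as an integral in \<open>t\<close> with
  the derivative of the normalised phase as density. The frequency is a real argument because it
  is evaluated at \<open>\<omega> \<plusminus> num_periods \<phi>\<close>.\<close>

definition phase_fourier :: "(real \<Rightarrow> real) \<Rightarrow> (real \<Rightarrow> real) \<Rightarrow> real \<Rightarrow> complex" where
  "phase_fourier \<phi> g x = integral {0..1}
     (\<lambda>t. complex_of_real (g t) * expi (- (x * norm_phase \<phi> t))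
          * complex_of_real (deriv01 (norm_phase \<phi>) t))"

definition cutoff :: "real \<Rightarrow> real" where
  "cutoff x = (if - 1 / 2 < x \<and> x < 1 / 2 then 1 else 0)"

text \<open>For a real signal \<open>f\<close> the coefficients at \<open>\<omega>\<close> and \<open>-\<omega>\<close> are complex conjugates, so both
  sums are real and taking real parts only changes the type. For \<open>num_periods \<phi> > 0\<close> the cutoff
  makes the sums finite.\<close>

definition coef_a :: "(real \<Rightarrow> real) \<Rightarrow> (real \<Rightarrow> real) \<Rightarrow> real \<Rightarrow> real" where
  "coef_a f \<phi> t = Re (\<Sum>\<^sub>\<infinity>\<omega>\<in>(UNIV :: int set).
     (phase_fourier \<phi> f (real_of_int \<omega> + num_periods \<phi>)
        + phase_fourier \<phi> f (real_of_int \<omega> - num_periods \<phi>))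
     * complex_of_real (cutoff (real_of_int \<omega> / num_periods \<phi>))
     * expi (real_of_int \<omega> * norm_phase \<phi> t))"

definition coef_b :: "(real \<Rightarrow> real) \<Rightarrow> (real \<Rightarrow> real) \<Rightarrow> real \<Rightarrow> real" where
  "coef_b f \<phi> t = Re (\<Sum>\<^sub>\<infinity>\<omega>\<in>(UNIV :: int set).
     (- \<i>) * (phase_fourier \<phi> f (real_of_int \<omega> + num_periods \<phi>)
        - phase_fourier \<phi> f (real_of_int \<omega> - num_periods \<phi>))
     * complex_of_real (cutoff (real_of_int \<omega> / num_periods \<phi>))
     * expi (real_of_int \<omega> * norm_phase \<phi> t))"

text \<open>The derivative is the pointwise one. At an isolated zero of \<open>coef_a\<close> the principal value of
  the arctangent jumps by \<open>\<pi>\<close>; such points form a null set and do not influence the projection,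
  so the jumps do not contribute. If \<open>coef_a\<close> vanishes identically, \<open>x / 0 = 0\<close> gives derivative
  0, as for the constant angle \<open>\<plusminus>\<pi>/2\<close>.\<close>

definition phase_incr_deriv :: "nat \<Rightarrow> (real \<Rightarrow> real) \<Rightarrow> (real \<Rightarrow> real) \<Rightarrow> real \<Rightarrow> real" where
  "phase_incr_deriv M f \<phi> =
     proj_trig M (deriv01 (\<lambda>t. arctan (coef_b f \<phi> t / coef_a f \<phi> t)))"

definition phase_incr :: "nat \<Rightarrow> (real \<Rightarrow> real) \<Rightarrow> (real \<Rightarrow> real) \<Rightarrow> real \<Rightarrow> real" where
  "phase_incr M f \<phi> t = integral {0..t} (phase_incr_deriv M f \<phi>)"

definition step_size :: "nat \<Rightarrow> (real \<Rightarrow> real) \<Rightarrow> (real \<Rightarrow> real) \<Rightarrow> real" where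
  "step_size M f \<phi> = (GREATEST \<alpha>. \<alpha> \<in> {0..1} \<and>
     (\<forall>t\<in>{0..1}. deriv01 (\<lambda>s. \<phi> s + \<alpha> * phase_incr M f \<phi> s) t \<ge> 0))"

definition phase_step :: "nat \<Rightarrow> (real \<Rightarrow> real) \<Rightarrow> (real \<Rightarrow> real) \<Rightarrow> real \<Rightarrow> real" where
  "phase_step M f \<phi> t = \<phi> t + step_size M f \<phi> * phase_incr M f \<phi> t"

primrec phase_iter :: "nat \<Rightarrow> (real \<Rightarrow> real) \<Rightarrow> (real \<Rightarrow> real) \<Rightarrow> nat \<Rightarrow> real \<Rightarrow> real" where
  "phase_iter M f \<theta>0 0 = \<theta>0"
| "phase_iter M f \<theta>0 (Suc m) = phase_step M f (phase_iter M f \<theta>0 m)"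

definition signal :: "(real \<Rightarrow> real) \<Rightarrow> (real \<Rightarrow> real) \<Rightarrow> (real \<Rightarrow> real) \<Rightarrow> real \<Rightarrow> real" where
  "signal f0 f1 \<theta> t = f0 t + f1 t * cos (\<theta> t)"

definition fast_decay :: "real \<Rightarrow> real \<Rightarrow> (real \<Rightarrow> real) \<Rightarrow> (real \<Rightarrow> real) \<Rightarrow> bool" where
  "fast_decay C p \<theta> g \<longleftrightarrow> (\<forall>k :: int. k \<noteq> 0 \<longrightarrow>
     norm (phase_fourier \<theta> g (real_of_int k)) \<le> C * \<bar>real_of_int k\<bar> powr (- p))"

definition phase_err :: "(real \<Rightarrow> real) \<Rightarrow> (real \<Rightarrow> real) \<Rightarrow> ennreal" where
  "phase_err \<phi> \<theta> = l1_norm (fourier (deriv01 (\<lambda>t. \<phi> t - \<theta> t)))"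

end

theory Submission
  imports Defs "HOL-Computational_Algebra.Polynomial"
begin

text \<open>Put \<open>\<psi> = \<theta> - \<theta>\<^sup>m\<close> and \<open>z = a + \<i> b\<close>. The sum \<open>z\<close> is twice the band-limited part of the
  signal, shifted by \<open>L\<^sup>m\<close> in the coordinate of \<open>\<theta>\<^sup>m\<close>, and should be close to \<open>f\<^sub>1 exp (\<i> \<psi>)\<close> up to a
  constant phase. To see this, split \<open>f\<^sub>0\<close> and \<open>f\<^sub>1\<close> at the frequency \<open>L / 4\<close> of the coordinate of \<open>\<theta>\<close>.
  The high parts are uniformly of order \<open>(L / 4)\<close> to the power \<open>- p + 1\<close> and enter through at most \<open>2 L\<close>
  coefficients, which gives the power \<open>- p + 2\<close> with a constant not depending on \<open>\<theta>\<close>. In the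
  coordinate of \<open>\<theta>\<^sup>m\<close> a low frequency acquires only a slowly varying factor whose \<open>n\<close>-th coefficient is
  of order \<open>E / n\<^sup>2\<close>, where \<open>E\<close> is the current error; since all misplaced frequencies are at
  distance at least \<open>L / 8\<close>, these terms contribute \<open>O (E / L)\<close>.

  No derivative of this error is needed: the angle of \<open>z exp (- \<i> \<psi>)\<close> is a small periodic function \<open>v\<close>
  with derivative \<open>Im (z' / z) - \<psi>'\<close>, so the coefficients of the new error are those of \<open>v'\<close>,
  i.e. \<open>2 \<pi> \<i> k\<close> times those of \<open>v\<close>, for \<open>\<bar>k\<bar> \<le> M\<^sub>0\<close>. In particular the coefficient of index 0
  vanishes, the number of periods is exact after one step, and the step size is 1.\<close>

subsection \<open>Exponentials and changes of coordinate on the unit interval\<close>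

text \<open>All constants must be uniform over the steps and over all signals with the same
  \<open>f1\<close> and normalised phase, since \<open>threshold\<close> is fixed before
  \<open>f0\<close> and \<open>\<theta>\<close> are known. Phases are therefore described by
  coefficients in the trigonometric space, and \<open>B\<close> is built only from \<open>M\<close>,
  the shape \<open>w\<close>, its lower bound \<open>c0\<close> and an a priori error bound
  \<open>E0\<close>. That bound reproduces itself: a new error is at most 1/2 plus half the old one,
  and \<open>E0 \<ge> 1\<close>. The distance L / 8 arises as follows. An error of at most
  \<open>L\<close> keeps \<open>L'\<close> within a quarter of \<open>L\<close>, so the pass band
  contains all frequencies below 3 L / 8, while the low parts stop at L / 4. The components
  \<open>f0\<close> and \<open>f1\<close> are merely continuous with decaying coefficients in a
  curved coordinate. Inversion with an explicit tail is needed pointwise, without knowing beforehand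
  that the values of each component at 0 and 1 agree; this shapes the uniqueness argument. Estimates
  are in the sup norm because the angle is taken pointwise; as only 2 M0 + 1 of its coefficients
  survive, passing to the l1 norm of a derivative costs a fixed factor.\<close>

lemma expi_add: "expi (x + y) = expi x * expi y"
  by (simp add: expi_def exp_add[symmetric] algebra_simps)

lemma norm_expi [simp]: "norm (expi x) = 1"
  using norm_exp_i_times[of "2 * pi * x"] by (simp add: expi_def)

lemma expi_nonzero [simp]: "expi x \<noteq> 0"
  by (simp add: expi_def)

lemma expi_0 [simp]: "expi 0 = 1"
  by (simp add: expi_def)

lemma expi_of_int [simp]: "expi (of_int n) = 1"
proof -
  have "\<i> * complex_of_real (2 * pi * of_int n) = of_int (2 * n) * pi * \<i>"
    by simp
  then show ?thesis
    unfolding expi_def exp_eq_1 by auto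
qed

lemma expi_minus_of_int [simp]: "expi (- of_int n) = 1"
  using expi_of_int[of "- n"] by simp

lemma cnj_expi [simp]: "cnj (expi x) = expi (- x)"
  by (simp add: expi_def exp_cnj)

lemma expi_has_vector_derivative:
  fixes f :: "real \<Rightarrow> real"
  assumes "(f has_vector_derivative f') (at x within A)"
  shows "((\<lambda>t. expi (f t)) has_vector_derivative
           2 * pi * \<i> * of_real f' * expi (f x)) (at x within A)"
proof -
  have "((\<lambda>t. \<i> * of_real (2 * pi * f t)) has_vector_derivative \<i> * of_real (2 * pi * f'))
          (at x within A)"
    using has_vector_derivative_mult_right[OF assms, of "2 * pi"]
    by (intro has_vector_derivative_mult_right has_vector_derivative_of_real)
       (simp add: has_real_derivative_iff_has_vector_derivative)
  from field_vector_diff_chain_within[OF this, of exp "exp (\<i> * of_real (2 * pi * f x))"]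
  show ?thesis
    by (auto simp: o_def expi_def mult_ac DERIV_exp intro: DERIV_subset[OF DERIV_exp])
qed

lemma continuous_on_expi [continuous_intros]:
  "continuous_on A f \<Longrightarrow> continuous_on A (\<lambda>x. expi (f x))"
  unfolding expi_def by (intro continuous_intros)

lemma integral_by_parts_periodic:
  fixes u v :: "real \<Rightarrow> complex"
  assumes u: "\<And>t. t \<in> {0..1} \<Longrightarrow> (u has_vector_derivative u' t) (at t within {0..1})"
    and v: "\<And>t. t \<in> {0..1} \<Longrightarrow> (v has_vector_derivative v' t) (at t within {0..1})"
    and cont: "continuous_on {0..1} u'" "continuous_on {0..1} v'"
    and per: "u 0 * v 0 = u 1 * v 1"
  shows "integral {0..1} (\<lambda>t. u t * v' t) = - integral {0..1} (\<lambda>t. u' t * v t)"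
proof -
  have cu: "continuous_on {0..1} u" and cv: "continuous_on {0..1} v"
    using continuous_on_vector_derivative[of "{0..1}", OF u]
      continuous_on_vector_derivative[of "{0..1}", OF v] by blast+
  have "((\<lambda>t. u t * v' t + u' t * v t) has_integral u 1 * v 1 - u 0 * v 0) {0..1}"
    by (intro fundamental_theorem_of_calculus has_vector_derivative_mult u v) auto
  then have "integral {0..1} (\<lambda>t. u t * v' t + u' t * v t) = 0"
    using per by (simp add: integral_unique)
  moreover have "integral {0..1} (\<lambda>t. u t * v' t + u' t * v t)
      = integral {0..1} (\<lambda>t. u t * v' t) + integral {0..1} (\<lambda>t. u' t * v t)"
    by (intro integral_add integrable_continuous_real continuous_intros cu cv cont)
  ultimately show ?thesis
    by (simp add: eq_neg_iff_add_eq_0)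
qed

section \<open>Fourier coefficients in the coordinate of an increasing reparametrisation\<close>

locale unit_phase =
  fixes s \<rho> :: "real \<Rightarrow> real"
  assumes s_deriv: "t \<in> {0..1} \<Longrightarrow> (s has_vector_derivative \<rho> t) (at t within {0..1})"
    and \<rho>_cont: "continuous_on {0..1} \<rho>"
    and \<rho>_pos: "t \<in> {0..1} \<Longrightarrow> \<rho> t > 0"
    and s_0: "s 0 = 0" and s_1: "s 1 = 1"
begin

text \<open>By the substitution \<open>x = s t\<close> this is the ordinary Fourier coefficient of
  \<open>g\<close> composed with the inverse of \<open>s\<close>. Keeping \<open>t\<close> as the
  integration variable means that the inverse never has to be formed.\<close>

definition coef :: "(real \<Rightarrow> complex) \<Rightarrow> int \<Rightarrow> complex" where
  "coef g n = integral {0..1} (\<lambda>t. g t * expi (- (of_int n * s t)) * of_real (\<rho> t))"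

lemma s_cont: "continuous_on {0..1} s"
  using s_deriv by (rule continuous_on_vector_derivative)

lemma s_strict_mono: "0 \<le> x \<Longrightarrow> x < y \<Longrightarrow> y \<le> 1 \<Longrightarrow> s x < s y"
proof -
  assume "0 \<le> x" "x < y" "y \<le> 1"
  have sub: "{x..y} \<subseteq> {0..1}"
    using \<open>0 \<le> x\<close> \<open>y \<le> 1\<close> by auto
  show "s x < s y"
  proof (rule DERIV_pos_imp_increasing_open[OF \<open>x < y\<close>])
    fix t assume t: "x < t" "t < y"
    then have "at t within {0..1} = at t"
      using \<open>0 \<le> x\<close> \<open>y \<le> 1\<close> by (intro at_within_interior) auto
    then show "\<exists>d. (s has_real_derivative d) (at t) \<and> 0 < d"
      using s_deriv[of t] \<rho>_pos[of t] t sub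
      by (auto simp: has_real_derivative_iff_has_vector_derivative)
  qed (rule continuous_on_subset[OF s_cont sub])
qed

lemma \<rho>_integral: "(\<rho> has_integral 1) {0..1}"
  using fundamental_theorem_of_calculus[of 0 1 s \<rho>] s_deriv s_0 s_1 by simp

lemma coef_integrable:
  "continuous_on {0..1} g \<Longrightarrow>
   (\<lambda>t. g t * expi (- (of_int n * s t)) * of_real (\<rho> t)) integrable_on {0..1}"
  by (intro integrable_continuous_real continuous_intros s_cont \<rho>_cont)

lemma coef_add:
  "continuous_on {0..1} g \<Longrightarrow> continuous_on {0..1} h \<Longrightarrow>
   coef (\<lambda>t. g t + h t) n = coef g n + coef h n"
  unfolding coef_def distrib_right by (intro integral_add coef_integrable)

lemma coef_cmult: "coef (\<lambda>t. c * g t) n = c * coef g n"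
  unfolding coef_def mult.assoc by (rule integral_mult_right)

lemma coef_diff:
  "continuous_on {0..1} g \<Longrightarrow> continuous_on {0..1} h \<Longrightarrow>
   coef (\<lambda>t. g t - h t) n = coef g n - coef h n"
  unfolding coef_def left_diff_distrib by (intro integral_diff coef_integrable)

lemma coef_sum:
  "finite A \<Longrightarrow> (\<And>a. a \<in> A \<Longrightarrow> continuous_on {0..1} (g a)) \<Longrightarrow>
   coef (\<lambda>t. \<Sum>a\<in>A. g a t) n = (\<Sum>a\<in>A. coef (g a) n)"
  unfolding coef_def sum_distrib_right by (intro integral_sum coef_integrable) auto

lemma coef_cong: "(\<And>t. t \<in> {0..1} \<Longrightarrow> g t = h t) \<Longrightarrow> coef g n = coef h n"
  unfolding coef_def by (intro integral_cong) auto

lemma coef_cnj: "coef (\<lambda>t. cnj (g t)) n = cnj (coef g (- n))"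
  unfolding coef_def integral_cnj by simp

lemma coef_shift: "coef (\<lambda>t. expi (of_int k * s t) * g t) n = coef g (n - k)"
  unfolding coef_def
  by (intro integral_cong)
     (simp add: mult.left_commute[of _ "g _"] expi_add[symmetric] algebra_simps)

lemma norm_coef_le:
  assumes "continuous_on {0..1} g" "\<And>t. t \<in> {0..1} \<Longrightarrow> norm (g t) \<le> B"
  shows "norm (coef g n) \<le> B"
proof -
  have "norm (coef g n) \<le> integral {0..1} (\<lambda>t. B * \<rho> t)"
    unfolding coef_def
  proof (rule integral_norm_bound_integral)
    show "(\<lambda>t. B * \<rho> t) integrable_on {0..1}"
      by (intro integrable_continuous_real continuous_intros \<rho>_cont)
    show "norm (g t * expi (- (of_int n * s t)) * of_real (\<rho> t)) \<le> B * \<rho> t"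
      if "t \<in> {0..1}" for t
      using assms(2)[OF that] \<rho>_pos[OF that] by (simp add: norm_mult mult_right_mono)
  qed (rule coef_integrable[OF assms(1)])
  also have "\<dots> = B"
    using \<rho>_integral by (simp add: integral_unique)
  finally show ?thesis .
qed

text \<open>The derivative with respect to the coordinate \<open>s\<close> is
  \<open>g' / \<rho>\<close>, so this is the usual rule for the coefficients of a derivative; the
  boundary terms cancel because the exponential is 1 at both ends.\<close>

lemma coef_by_parts:
  assumes g: "\<And>t. t \<in> {0..1} \<Longrightarrow> (g has_vector_derivative g' t) (at t within {0..1})"
    and g': "continuous_on {0..1} g'" and per: "g 0 = g 1"
  shows "2 * pi * \<i> * of_int n * coef g n = coef (\<lambda>t. g' t / of_real (\<rho> t)) n"
proof -
  let ?E = "\<lambda>t. expi (- (of_int n * s t))"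
  have E: "(?E has_vector_derivative - (2 * pi * \<i> * of_int n) * (?E t * of_real (\<rho> t)))
        (at t within {0..1})" if "t \<in> {0..1}" for t
  proof -
    have "((\<lambda>t. (- of_int n) * s t) has_vector_derivative (- of_int n) * \<rho> t) (at t within {0..1})"
      by (intro has_vector_derivative_mult_right s_deriv that)
    from expi_has_vector_derivative[OF this] show ?thesis
      by (simp add: mult_ac)
  qed
  have "integral {0..1} (\<lambda>t. g t * (- (2 * pi * \<i> * of_int n) * (?E t * of_real (\<rho> t))))
      = - integral {0..1} (\<lambda>t. g' t * ?E t)"
    by (intro integral_by_parts_periodic g E g' continuous_intros s_cont \<rho>_cont)
       (simp_all add: s_0 s_1 per)
  also have "integral {0..1} (\<lambda>t. g t * (- (2 * pi * \<i> * of_int n) * (?E t * of_real (\<rho> t))))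
      = - (2 * pi * \<i> * of_int n) * coef g n"
    unfolding coef_def integral_mult_right[symmetric] by (intro integral_cong) (simp add: mult_ac)
  also have "integral {0..1} (\<lambda>t. g' t * ?E t) = coef (\<lambda>t. g' t / of_real (\<rho> t)) n"
    unfolding coef_def
  proof (rule integral_cong)
    fix t :: real assume "t \<in> {0..1}"
    then show "g' t * ?E t = g' t / of_real (\<rho> t) * ?E t * of_real (\<rho> t)"
      using \<rho>_pos[of t] by simp
  qed
  finally show ?thesis by simp
qed

lemma coef_const: "coef (\<lambda>t. c) n = (if n = 0 then c else 0)"
proof (cases "n = 0")
  case True
  have "((\<lambda>t. complex_of_real (\<rho> t)) has_integral of_real 1) {0..1}"
    by (intro has_integral_of_real \<rho>_integral)
  then show ?thesis using True has_integral_mult_right[of "\<lambda>t. complex_of_real (\<rho> t)" 1 "{0..1}" c]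
    by (simp add: coef_def integral_unique)
next
  case False
  have "2 * pi * \<i> * of_int n * coef (\<lambda>t. c) n = coef (\<lambda>t. 0 / of_real (\<rho> t)) n"
    by (intro coef_by_parts) auto
  then show ?thesis using False by (simp add: coef_def)
qed

lemma coef_expi: "coef (\<lambda>t. expi (of_int k * s t)) n = (if n = k then 1 else 0)"
  using coef_shift[of k "\<lambda>t. 1" n] by (simp add: coef_const)

end

subsection \<open>Uniqueness of Fourier coefficients\<close>

context unit_phase
begin

definition null_coefs :: "(real \<Rightarrow> complex) \<Rightarrow> bool" where
  "null_coefs g \<longleftrightarrow> continuous_on {0..1} g \<and> (\<forall>n. coef g n = 0)"

lemma null_coefs_cmult: "null_coefs g \<Longrightarrow> null_coefs (\<lambda>t. c * g t)"
  unfolding null_coefs_def by (auto simp: coef_cmult intro: continuous_intros)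

lemma null_coefs_add: "null_coefs g \<Longrightarrow> null_coefs h \<Longrightarrow> null_coefs (\<lambda>t. g t + h t)"
  unfolding null_coefs_def by (auto simp: coef_add intro: continuous_intros)

lemma null_coefs_cnj: "null_coefs g \<Longrightarrow> null_coefs (\<lambda>t. cnj (g t))"
  unfolding null_coefs_def by (auto simp: coef_cnj intro: continuous_intros)

lemma null_coefs_shift: "null_coefs g \<Longrightarrow> null_coefs (\<lambda>t. expi (of_int k * s t) * g t)"
  unfolding null_coefs_def by (auto simp: coef_shift intro!: continuous_intros s_cont)

text \<open>The real and imaginary parts of \<open>expi (s t)\<close> are combinations of
  \<open>expi (s t)\<close> and \<open>expi (- s t)\<close>, and multiplying by these only shifts
  the index; sums and products of such multipliers inherit the property.\<close>

lemma null_coefs_mult_polynomial: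
  assumes "real_polynomial_function p" "null_coefs g"
  shows "null_coefs (\<lambda>t. of_real (p (expi (s t))) * g t)"
  using assms
proof (induction p arbitrary: g rule: real_polynomial_function.induct)
  case (linear f)
  have "complex_of_real (f (expi (s t))) * g t =
      (of_real (f 1) / 2 - \<i> / 2 * of_real (f \<i>)) * (expi (of_int 1 * s t) * g t)
      + (of_real (f 1) / 2 + \<i> / 2 * of_real (f \<i>)) * (expi (of_int (- 1) * s t) * g t)" for t
  proof -
    let ?z = "expi (s t)"
    have "?z = Re ?z *\<^sub>R 1 + Im ?z *\<^sub>R \<i>"
      by (simp add: complex_eq_iff)
    then have "f ?z = f (Re ?z *\<^sub>R 1 + Im ?z *\<^sub>R \<i>)"
      by (rule arg_cong)
    also have "\<dots> = Re ?z * f 1 + Im ?z * f \<i>"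
      using linear(1) by (simp add: linear_simps)
    finally have f: "f ?z = Re ?z * f 1 + Im ?z * f \<i>" .
    have "complex_of_real (Re z) = (z + cnj z) / 2"
        "complex_of_real (Im z) = \<i> / 2 * (cnj z - z)" for z
      by (simp_all add: complex_eq_iff)
    note eq = this[of ?z, unfolded cnj_expi]
    show ?thesis
      unfolding f of_real_add of_real_mult eq by (simp add: algebra_simps)
  qed
  then show ?case
    using linear(2) by (simp only: null_coefs_add null_coefs_cmult null_coefs_shift)
next
  case (const c)
  then show ?case by (simp add: null_coefs_cmult)
next
  case (add f h)
  then show ?case by (simp add: null_coefs_add distrib_right)
next
  case (mult f h)
  from mult(3)[OF mult(4)[OF mult(5)]] show ?case by (simp add: mult.assoc)
qed

lemma s_inj:
  assumes "t \<in> {0..1}" "t' \<in> {0..1}" "expi (s t) = expi (s t')"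
  shows "t = t' \<or> {t, t'} = {0, 1}"
proof -
  have mono: "s x < s y" if "x < y" "x \<in> {0..1}" "y \<in> {0..1}" for x y
    using s_strict_mono that by auto
  have wlog: "x = 0 \<and> y = 1" if "x < y" "x \<in> {0..1}" "y \<in> {0..1}" "expi (s x) = expi (s y)" for x y
  proof -
    obtain n :: int where "\<i> * complex_of_real (2 * pi * s y) =
        \<i> * complex_of_real (2 * pi * s x) + of_int (2 * n) * pi * \<i>"
      using \<open>expi (s x) = expi (s y)\<close>[symmetric] unfolding expi_def exp_eq by blast
    then have "2 * pi * s y = 2 * pi * (s x + of_int n)"
      by (auto simp: complex_eq_iff algebra_simps)
    then have n: "s y = s x + of_int n" by simp
    have "s y - s x > 0" using mono that by auto
    have x: "s 0 < s x" if "x \<noteq> 0" using mono[of 0 x] \<open>x \<in> _\<close> that by auto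
    have y: "s y < s 1" if "y \<noteq> 1" using mono[of y 1] \<open>y \<in> _\<close> that by auto
    have "x \<noteq> 0 \<or> y \<noteq> 1 \<Longrightarrow> of_int n < (1::real)"
      using n x y s_0 s_1 mono[of 0 x] mono[of y 1] that(1-3) by fastforce
    moreover have "of_int n > (0::real)" using n \<open>s y - s x > 0\<close> by simp
    ultimately show ?thesis by auto
  qed
  show ?thesis
    using wlog[of t t'] wlog[of t' t] assms by (cases t t' rule: linorder_cases) auto
qed

lemma s_surj:
  assumes "norm z = 1"
  obtains t where "t \<in> {0..1}" "expi (s t) = z"
proof -
  have z: "z = exp (\<i> * of_real (Arg2pi z))"
    using Arg2pi_eq[of z] assms by simp
  have "0 \<le> Arg2pi z / (2 * pi)" "Arg2pi z / (2 * pi) \<le> 1"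
    using Arg2pi_ge_0[of z] Arg2pi_lt_2pi[of z] by (auto simp: field_simps)
  then obtain t where "t \<in> {0..1}" "s t = Arg2pi z / (2 * pi)"
    using IVT'[of s 0 "Arg2pi z / (2 * pi)" 1] s_cont s_0 s_1 by auto
  then show ?thesis
    using z that[of t] by (simp add: expi_def)
qed

text \<open>A periodic \<open>h\<close> is a continuous function on the circle, hence within
  \<open>e\<close> of a polynomial \<open>p\<close> of \<open>expi (s t)\<close>. Since
  \<open>p * h\<close> has integral 0 against \<open>\<rho>\<close>, the integral of
  \<open>h * h\<close> equals that of \<open>(h - p) * h\<close> and is at most
  \<open>e * B\<close>.\<close>

lemma real_null_coefs_periodic_eq_0:
  fixes h :: "real \<Rightarrow> real"
  assumes null: "null_coefs (\<lambda>t. of_real (h t))" and per: "h 0 = h 1" and t: "t \<in> {0..1}"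
  shows "h t = 0"
proof -
  define \<gamma> where "\<gamma> = (\<lambda>t. expi (s t))"
  \<comment> \<open>\<open>h\<close> transported to the circle. The choice of a preimage is
    harmless: only the endpoints share an image, and there \<open>h 0 = h 1\<close>.\<close>
  define F where "F = (\<lambda>z. h (SOME t. t \<in> {0..1} \<and> \<gamma> t = z))"
  have h_cont: "continuous_on {0..1} h"
    using null continuous_on_Re[of "{0..1}" "\<lambda>t. complex_of_real (h t)"]
    by (simp add: null_coefs_def)
  have F: "F (\<gamma> t) = h t" if "t \<in> {0..1}" for t
  proof -
    define t' where "t' = (SOME x. x \<in> {0..1} \<and> \<gamma> x = \<gamma> t)"
    have "t' \<in> {0..1} \<and> \<gamma> t' = \<gamma> t"
      unfolding t'_def by (rule someI[of _ t]) (use that in auto)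
    then have "t' = t \<or> {t', t} = {0, 1}"
      using s_inj[of t' t] that by (auto simp: \<gamma>_def)
    then show ?thesis
      using per unfolding F_def t'_def[symmetric] by (auto simp: doubleton_eq_iff)
  qed
  have img: "\<gamma> ` {0..1} = sphere 0 1"
    using s_surj by (force simp: \<gamma>_def)
  have \<gamma>_cont: "continuous_on {0..1} \<gamma>"
    unfolding \<gamma>_def by (intro continuous_intros s_cont)
  have F_cont: "continuous_on (sphere 0 1) F"
    unfolding continuous_on_open_gen[of F "sphere 0 1" UNIV, simplified]
  proof safe
    fix U :: "real set" assume "open U"
    let ?W = "sphere 0 1 \<inter> F -` U"
    have "{0..1} \<inter> \<gamma> -` ?W = {0..1} \<inter> h -` U"
      using F img by auto
    moreover have "openin (top_of_set {0..1}) ({0..1} \<inter> h -` U)"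
      using h_cont \<open>open U\<close> by (rule continuous_openin_preimage_gen)
    \<comment> \<open>The parametrisation maps a compact interval continuously onto the circle,
      hence is a quotient map, so continuity of \<open>F\<close> can be tested on the
      interval.\<close>
    ultimately show "openin (top_of_set (sphere 0 1)) ?W"
      using Abstract_Topology_2.continuous_imp_quotient_map[OF \<gamma>_cont img compact_Icc, of ?W] by simp
  qed
  obtain B where B: "B > 0" "\<And>t. t \<in> {0..1} \<Longrightarrow> \<bar>h t\<bar> \<le> B"
    using compact_imp_bounded[OF compact_continuous_image[OF h_cont compact_Icc]]
    by (auto simp: bounded_pos)
  let ?J = "norm (coef (\<lambda>t. of_real (h t) * of_real (h t)) 0)"
  have "?J \<le> e * B" if "e > 0" for e
  proof -
    obtain p where p: "real_polynomial_function p" "\<And>z. z \<in> sphere 0 1 \<Longrightarrow> \<bar>F z - p z\<bar> < e"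
      using Stone_Weierstrass_real_polynomial_function[OF compact_sphere F_cont \<open>e > 0\<close>] by blast
    have pn: "null_coefs (\<lambda>t. of_real (p (expi (s t))) * of_real (h t))"
      by (rule null_coefs_mult_polynomial[OF p(1) null])
    have hc: "continuous_on {0..1} (\<lambda>t. complex_of_real (h t) * of_real (h t))"
      by (intro continuous_intros h_cont)
    have "coef (\<lambda>t. of_real (h t) * of_real (h t) - of_real (p (expi (s t))) * of_real (h t)) 0
        = coef (\<lambda>t. of_real (h t) * of_real (h t)) 0"
      using pn hc by (subst coef_diff) (auto simp: null_coefs_def)
    moreover have "norm (coef (\<lambda>t. of_real (h t) * of_real (h t) - of_real (p (expi (s t))) * of_real (h t)) 0)
        \<le> e * B"
    proof (rule norm_coef_le)
      show "continuous_on {0..1} (\<lambda>t. complex_of_real (h t) * of_real (h t) - of_real (p (expi (s t))) * of_real (h t))"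
        using pn hc by (auto simp: null_coefs_def intro: continuous_intros)
      fix t :: real assume t: "t \<in> {0..1}"
      have "\<bar>h t - p (\<gamma> t)\<bar> \<le> e"
        using p(2)[of "\<gamma> t"] F[OF t] by (simp add: \<gamma>_def)
      then have "\<bar>h t - p (\<gamma> t)\<bar> * \<bar>h t\<bar> \<le> e * B"
        using B that t by (intro mult_mono) auto
      moreover have "complex_of_real (h t) * of_real (h t) - of_real (p (expi (s t))) * of_real (h t)
          = of_real ((h t - p (\<gamma> t)) * h t)"
        by (simp add: \<gamma>_def algebra_simps)
      ultimately show "norm (complex_of_real (h t) * of_real (h t) - of_real (p (expi (s t))) * of_real (h t)) \<le> e * B"
        by (simp only: norm_of_real abs_mult)
    qed
    ultimately show ?thesis by simp
  qed
  then have J: "?J \<le> (e / B) * B" if "e > 0" for e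
    using B(1) that by (meson divide_pos_pos)
  have "?J \<le> 0"
    by (rule field_le_epsilon) (use J B(1) in simp)
  then have "?J = 0"
    by simp
  have cont: "continuous_on {0..1} (\<lambda>t. h t * h t * \<rho> t)"
    by (intro continuous_intros h_cont \<rho>_cont)
  then obtain I where I: "((\<lambda>t. h t * h t * \<rho> t) has_integral I) {0..1}"
    using integrable_continuous_real unfolding integrable_on_def by blast
  have "I = 0"
    using has_integral_of_real[OF I, where 'b = complex] \<open>?J = 0\<close>
    by (simp add: coef_def integral_unique)
  with I have "((\<lambda>t. h t * h t * \<rho> t) has_integral 0) {0..1}"
    by simp
  then have "h t * h t * \<rho> t = 0"
    using cont has_integral_0_cbox_imp_0[of 0 1 "\<lambda>t. h t * h t * \<rho> t" t] \<rho>_pos t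
    by (simp add: less_imp_le)
  then show ?thesis
    using \<rho>_pos[OF t] by simp
qed

lemma null_coefs_periodic_eq_0:
  assumes null: "null_coefs g" and per: "g 0 = g 1" and t: "t \<in> {0..1}"
  shows "g t = 0"
proof -
  have "null_coefs (\<lambda>t. 1/2 * (g t + cnj (g t)))" "null_coefs (\<lambda>t. 1/(2*\<i>) * (g t + (- 1) * cnj (g t)))"
    by (intro null_coefs_cmult null_coefs_add null null_coefs_cnj)+
  moreover have "1/2 * (z + cnj z) = of_real (Re z)" "1/(2*\<i>) * (z + (- 1) * cnj z) = of_real (Im z)" for z
    by (simp_all add: complex_eq_iff)
  ultimately have "null_coefs (\<lambda>t. of_real (Re (g t)))" "null_coefs (\<lambda>t. of_real (Im (g t)))"
    by simp_all
  from this[THEN real_null_coefs_periodic_eq_0, OF _ t] per show ?thesis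
    by (simp add: complex_eq_iff)
qed

text \<open>The density argument needs equal values at the endpoints; a primitive of a function of
  mean zero has them.\<close>

lemma null_coefs_eq_0:
  assumes null: "null_coefs g" and t: "t \<in> {0..1}"
  shows "g t = 0"
proof -
  have g: "continuous_on {0..1} g" "\<And>n. coef g n = 0"
    using null by (auto simp: null_coefs_def)
  define G where "G = (\<lambda>t. integral {0..t} (\<lambda>x. g x * of_real (\<rho> x)))"
  have G: "(G has_vector_derivative g t * of_real (\<rho> t)) (at t within {0..1})" if "t \<in> {0..1}" for t
    unfolding G_def
    by (rule integral_has_vector_derivative[OF _ that]) (intro continuous_intros g \<rho>_cont)
  have G_cont: "continuous_on {0..1} G"
    using continuous_on_vector_derivative[of "{0..1}", OF G] by blast
  have per: "G 0 = G 1"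
    using g(2)[of 0] by (simp add: G_def coef_def)
  have "coef G n = 0" if "n \<noteq> 0" for n
  proof -
    have "2 * pi * \<i> * of_int n * coef G n = coef (\<lambda>t. g t * of_real (\<rho> t) / of_real (\<rho> t)) n"
      by (intro coef_by_parts G per continuous_intros g \<rho>_cont)
    also have "\<dots> = coef g n"
      using \<rho>_pos by (intro coef_cong) (metis nonzero_mult_div_cancel_right of_real_eq_0_iff order_less_irrefl)
    finally show ?thesis
      using g that by simp
  qed
  \<comment> \<open>Only the mean of the primitive can be nonzero. Removing it leaves null
    coefficients and equal endpoint values, so the primitive is constant and its derivative
    vanishes.\<close>
  then have "null_coefs (\<lambda>t. G t - coef G 0)"
    unfolding null_coefs_def
    by (auto simp: coef_diff[OF G_cont] coef_const intro: continuous_intros G_cont)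
  from null_coefs_periodic_eq_0[OF this] have G_const: "G x = coef G 0" if "x \<in> {0..1}" for x
    using per that by simp
  have "(G has_vector_derivative 0) (at t within {0..1})"
    by (rule has_vector_derivative_transform[OF t _ has_vector_derivative_const[of "coef G 0"]])
       (use G_const in auto)
  then have "g t * of_real (\<rho> t) = 0"
    using G[OF t] t vector_derivative_unique_within_closed_interval[of 0 1 t G 0] by force
  then show ?thesis
    using \<rho>_pos[OF t] by simp
qed

end

subsection \<open>Fourier inversion with a tail bound\<close>

text \<open>Telescoping with \<open>1 / n\<^sup>2 \<le> 1 / (n - 1) - 1 / n\<close>. The first term
  is estimated by \<open>1 / m\<close> instead, which admits \<open>m = 1\<close>, and the
  subtracted \<open>1 / N\<close> carries the induction.\<close>

lemma sum_inverse_squares_le: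
  assumes "1 \<le> m" "m \<le> N"
  shows "(\<Sum>n=m..N. 1 / (real n)\<^sup>2) \<le> 2 / real m - 1 / real N"
  using assms(2)
proof (induction N rule: dec_induct)
  case base
  then show ?case using assms(1) by (simp add: power2_eq_square field_simps)
next
  case (step n)
  have "1 / (real (Suc n))\<^sup>2 \<le> 1 / real n - 1 / real (Suc n)"
  proof -
    have "1 / real n - 1 / real (Suc n) = 1 / (real n * real (Suc n))"
      using step assms(1) by (simp add: field_simps)
    moreover have "1 / (real (Suc n))\<^sup>2 \<le> 1 / (real n * real (Suc n))"
      unfolding power2_eq_square using step assms(1) by (intro frac_le mult_mono) auto
    ultimately show ?thesis by simp
  qed
  then show ?case using step by simp
qed

lemma sum_inverse_squares_int_le:
  fixes J :: real
  assumes "finite F" "1 \<le> J" "\<And>j :: int. j \<in> F \<Longrightarrow> J \<le> \<bar>of_int j\<bar>"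
  shows "(\<Sum>j\<in>F. 1 / (real_of_int j)\<^sup>2) \<le> 4 / J"
proof -
  define m where "m = nat \<lceil>J\<rceil>"
  define N where "N = Max (insert m ((\<lambda>j. nat \<bar>j\<bar>) ` F))"
  have m: "1 \<le> m" "J \<le> real m"
    using assms(2) by (auto simp: m_def le_nat_iff intro: real_nat_ceiling_ge)
  have N: "m \<le> N" "\<And>j. j \<in> F \<Longrightarrow> nat \<bar>j\<bar> \<le> N"
    unfolding N_def using assms(1) by (auto intro: Max_ge)
  have sub: "F \<subseteq> int ` {m..N} \<union> (\<lambda>n. - int n) ` {m..N}"
  proof
    fix j assume j: "j \<in> F"
    have "\<lceil>J\<rceil> \<le> \<bar>j\<bar>"
      using assms(3)[OF j] by (simp add: ceiling_le_iff)
    then have "m \<le> nat \<bar>j\<bar>" unfolding m_def by (rule nat_mono)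
    with N(2)[OF j] have "nat \<bar>j\<bar> \<in> {m..N}" by simp
    moreover have "j = int (nat \<bar>j\<bar>) \<or> j = - int (nat \<bar>j\<bar>)" by linarith
    ultimately show "j \<in> int ` {m..N} \<union> (\<lambda>n. - int n) ` {m..N}" by blast
  qed
  have "(\<Sum>j\<in>F. 1 / (real_of_int j)\<^sup>2)
      \<le> (\<Sum>j\<in>int ` {m..N} \<union> (\<lambda>n. - int n) ` {m..N}. 1 / (real_of_int j)\<^sup>2)"
    by (intro sum_mono2 sub) auto
  also have "\<dots> \<le> (\<Sum>j\<in>int ` {m..N}. 1 / (real_of_int j)\<^sup>2) + (\<Sum>j\<in>(\<lambda>n. - int n) ` {m..N}. 1 / (real_of_int j)\<^sup>2)"
    by (subst sum_Un) (auto intro: sum_nonneg)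
  also have "\<dots> = 2 * (\<Sum>n=m..N. 1 / (real n)\<^sup>2)"
    by (simp add: sum.reindex inj_on_def)
  also have "\<dots> \<le> 2 * (2 / real m)"
  proof -
    have "0 \<le> 1 / real N" by simp
    with sum_inverse_squares_le[OF m(1) N(1)] show ?thesis by linarith
  qed
  also have "\<dots> \<le> 4 / J"
    using m assms(2) by (simp add: frac_le)
  finally show ?thesis .
qed

context unit_phase
begin

definition partial_sum :: "(real \<Rightarrow> complex) \<Rightarrow> int set \<Rightarrow> real \<Rightarrow> complex" where
  "partial_sum g S t = (\<Sum>j\<in>S. coef g j * expi (of_int j * s t))"

lemma partial_sum_cont: "continuous_on {0..1} (partial_sum g S)"
  unfolding partial_sum_def by (intro continuous_intros s_cont)

lemma coef_partial_sum:
  "finite S \<Longrightarrow> coef (partial_sum g S) n = (if n \<in> S then coef g n else 0)"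
  unfolding partial_sum_def
  by (subst coef_sum) (auto simp: coef_cmult coef_expi if_distrib cong: if_cong
      intro!: continuous_intros s_cont)

lemma partial_sum_diff_le:
  assumes "1 \<le> J" and D: "\<And>j. J \<le> \<bar>of_int j\<bar> \<Longrightarrow> norm (coef g j) \<le> D / (real_of_int j)\<^sup>2"
    and S: "finite S" "{j. \<bar>real_of_int j\<bar> < J} \<subseteq> S" and S': "finite S'" "S \<subseteq> S'" and "0 \<le> D"
  shows "norm (partial_sum g S' t - partial_sum g S t) \<le> 4 * D / J"
proof -
  have "partial_sum g S' t - partial_sum g S t = (\<Sum>j\<in>S' - S. coef g j * expi (of_int j * s t))"
    unfolding partial_sum_def using S' by (subst sum_diff) auto
  also have "norm \<dots> \<le> (\<Sum>j\<in>S' - S. D * (1 / (real_of_int j)\<^sup>2))"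
  proof (rule sum_norm_le)
    fix j assume "j \<in> S' - S"
    then have "J \<le> \<bar>of_int j\<bar>" using S(2) by force
    from D[OF this] show "norm (coef g j * expi (of_int j * s t)) \<le> D * (1 / (real_of_int j)\<^sup>2)"
      by (simp add: norm_mult)
  qed
  also have "\<dots> \<le> D * (4 / J)"
    unfolding sum_distrib_left[symmetric]
    using S S' assms(1,7) by (intro mult_left_mono sum_inverse_squares_int_le) force+
  finally show ?thesis by (simp add: mult.commute)
qed

text \<open>The symmetric partial sums are uniformly Cauchy; their limit is continuous with the
  coefficients of \<open>g\<close>, hence equals \<open>g\<close> by \<open>null_coefs_eq_0\<close>,
  and the tail estimate passes to the limit. \<open>S\<close> may be asymmetric, since later windows
  are translates of the band.\<close>

lemma partial_sum_error:
  assumes g: "continuous_on {0..1} g" and "1 \<le> J" "0 \<le> D"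
    and D: "\<And>j. J \<le> \<bar>of_int j\<bar> \<Longrightarrow> norm (coef g j) \<le> D / (real_of_int j)\<^sup>2"
    and S: "finite S" "{j. \<bar>real_of_int j\<bar> < J} \<subseteq> S" and t: "t \<in> {0..1}"
  shows "norm (g t - partial_sum g S t) \<le> 4 * D / J"
proof -
  define P where "P = (\<lambda>N::nat. partial_sum g {- int N..int N})"
  have Pcauchy: "norm (P M x - P N x) \<le> 4 * D / real N"
    if "J \<le> real N" "N \<le> M" for M N x
  proof -
    have "{j. \<bar>real_of_int j\<bar> < real N} \<subseteq> {- int N..int N}" by auto
    then show ?thesis unfolding P_def
      using that assms(2,3) by (intro partial_sum_diff_le D) auto
  qed
  have "uniformly_convergent_on {0..1} P"
    unfolding uniformly_convergent_eq_Cauchy uniformly_Cauchy_on_def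
  proof (intro allI impI)
    fix e :: real assume e: "e > 0"
    obtain N :: nat where N: "N > 0" "J \<le> real N" "4 * D / e < real N"
      using reals_Archimedean2[of "max J (4 * D / e)"] assms(2)
      by (metis less_imp_le max_less_iff_conj of_nat_0_less_iff order_less_le_trans zero_less_one)
    have lt: "4 * D / real N < e"
      using N e by (simp add: field_simps)
    have "dist (P m x) (P n x) < e" if "N \<le> m" "m \<le> n" for m n x
    proof -
      have "4 * D / real m \<le> 4 * D / real N"
        using N that assms(3) by (intro frac_le) auto
      then show ?thesis
        using Pcauchy[of m n x] N that lt by (simp add: dist_norm norm_minus_commute)
    qed
    then show "\<exists>M. \<forall>x\<in>{0..1}. \<forall>m\<ge>M. \<forall>n\<ge>M. dist (P m x) (P n x) < e"
      by (metis dist_commute nle_le)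
  qed
  then obtain l where l: "uniform_limit {0..1} P l sequentially"
    by (auto simp: uniformly_convergent_on_def)
  have l_cont: "continuous_on {0..1} l"
    using l by (rule uniform_limit_theorem[rotated]) (auto simp: P_def intro!: always_eventually partial_sum_cont)
  have "coef l n = coef g n" for n
  proof -
    have bdd: "norm (coef l n - coef g n) \<le> e" if "e > 0" for e
    proof -
      have "\<forall>\<^sub>F N in sequentially. (\<forall>x\<in>{0..1}. dist (P N x) (l x) < e) \<and> nat \<bar>n\<bar> \<le> N"
        using uniform_limitD[OF l \<open>e > 0\<close>] by (intro eventually_conj eventually_ge_at_top)
      then obtain N where N: "\<forall>x\<in>{0..1}. dist (P N x) (l x) < e" "nat \<bar>n\<bar> \<le> N"
        using eventually_happens'[OF sequentially_bot] by blast
      have "coef (P N) n = coef g n"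
        using N(2) by (auto simp: P_def coef_partial_sum)
      then have "coef l n - coef g n = coef (\<lambda>t. l t - P N t) n"
        by (subst coef_diff) (auto simp: P_def intro: l_cont partial_sum_cont)
      also have "norm \<dots> \<le> e"
        using N(1) by (intro norm_coef_le continuous_intros l_cont)
          (auto simp: P_def dist_norm norm_minus_commute less_imp_le intro: partial_sum_cont)
      finally show ?thesis .
    qed
    have "norm (coef l n - coef g n) \<le> 0"
      by (rule field_le_epsilon) (use bdd in simp)
    then show ?thesis by simp
  qed
  then have "null_coefs (\<lambda>t. g t - l t)"
    unfolding null_coefs_def
    by (simp add: coef_diff[OF g l_cont] continuous_on_diff[OF g l_cont])
  then have gl: "g t = l t"
    using null_coefs_eq_0[OF _ t] by force
  have "(\<lambda>N. norm (P N t - partial_sum g S t)) \<longlonglongrightarrow> norm (l t - partial_sum g S t)"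
    by (intro tendsto_intros tendsto_uniform_limitI[OF l t])
  moreover have "\<forall>\<^sub>F N in sequentially. norm (P N t - partial_sum g S t) \<le> 4 * D / J"
  proof (rule eventually_mono[OF eventually_ge_at_top])
    fix N :: nat assume N: "Max (insert 0 ((\<lambda>j. nat \<bar>j\<bar>) ` S)) \<le> N"
    have "S \<subseteq> {- int N..int N}"
    proof
      fix j assume "j \<in> S"
      then have "nat \<bar>j\<bar> \<le> N"
        using N S(1) by (auto simp: Max_le_iff)
      then show "j \<in> {- int N..int N}" by auto
    qed
    then show "norm (P N t - partial_sum g S t) \<le> 4 * D / J"
      unfolding P_def using assms by (intro partial_sum_diff_le D) auto
  qed
  ultimately show ?thesis
    unfolding gl using tendsto_upperbound[of _ "norm (l t - partial_sum g S t)" sequentially "4 * D / J"] by simp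
qed

end

context unit_phase
begin

text \<open>Two integrations by parts in the coordinate \<open>s\<close>.\<close>

lemma norm_coef_expi_le:
  fixes \<Phi> \<kappa> \<kappa>' \<rho>' :: "real \<Rightarrow> real"
  assumes \<Phi>: "\<And>t. t \<in> {0..1} \<Longrightarrow> (\<Phi> has_vector_derivative \<kappa> t) (at t within {0..1})"
    and \<kappa>: "\<And>t. t \<in> {0..1} \<Longrightarrow> (\<kappa> has_vector_derivative \<kappa>' t) (at t within {0..1})"
    and \<rho>: "\<And>t. t \<in> {0..1} \<Longrightarrow> (\<rho> has_vector_derivative \<rho>' t) (at t within {0..1})"
    and cont: "continuous_on {0..1} \<kappa>'" "continuous_on {0..1} \<rho>'"
    and per: "expi (\<Phi> 0) = expi (\<Phi> 1)" "\<kappa> 0 = \<kappa> 1" "\<rho> 0 = \<rho> 1"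
    and c: "c > 0" "\<And>t. t \<in> {0..1} \<Longrightarrow> c \<le> \<rho> t"
    and X: "\<And>t. t \<in> {0..1} \<Longrightarrow> \<bar>\<kappa> t\<bar> \<le> X"
    and Y: "\<And>t. t \<in> {0..1} \<Longrightarrow> \<bar>\<kappa>' t\<bar> \<le> Y"
    and R: "\<And>t. t \<in> {0..1} \<Longrightarrow> \<bar>\<rho>' t\<bar> \<le> R"
    and n: "n \<noteq> 0"
  shows "norm (coef (\<lambda>t. expi (\<Phi> t)) n) \<le> (Y / c^2 + X * R / c^3 + 2 * pi * X^2 / c^2) / (real_of_int n)\<^sup>2"
proof -
  let ?h = "\<lambda>t. expi (\<Phi> t)"
  \<comment> \<open>\<open>\<kappa> / \<rho>\<close> is the derivative of \<open>\<Phi>\<close> with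
    respect to \<open>s\<close>, so \<open>g\<close> is, up to \<open>2 \<pi> \<i>\<close>, the
    first derivative of the exponential in that coordinate.\<close>
  define m where "m = (\<lambda>t. \<kappa> t / \<rho> t)"
  define m' where "m' = (\<lambda>t. (\<kappa>' t * \<rho> t - \<kappa> t * \<rho>' t) / (\<rho> t * \<rho> t))"
  define g where "g = (\<lambda>t. of_real (m t) * ?h t)"
  define g' where "g' = (\<lambda>t. of_real (m' t) * ?h t + of_real (m t) * (2 * pi * \<i> * of_real (\<kappa> t) * ?h t))"
  have \<Phi>_cont: "continuous_on {0..1} \<Phi>" and \<kappa>_cont: "continuous_on {0..1} \<kappa>"
    using continuous_on_vector_derivative[of "{0..1}", OF \<Phi>]
      continuous_on_vector_derivative[of "{0..1}", OF \<kappa>] by blast+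
  have \<rho>_nz: "\<rho> t \<noteq> 0" if "t \<in> {0..1}" for t
    using \<rho>_pos[OF that] by simp
  have h: "(?h has_vector_derivative 2 * pi * \<i> * of_real (\<kappa> t) * ?h t) (at t within {0..1})"
    if "t \<in> {0..1}" for t
    using expi_has_vector_derivative[OF \<Phi>[OF that]] by (simp add: mult_ac)
  have m: "(m has_vector_derivative m' t) (at t within {0..1})" if "t \<in> {0..1}" for t
    unfolding m_def m'_def
    using DERIV_divide[of \<kappa> "\<kappa>' t" t "{0..1}" \<rho> "\<rho>' t"] \<kappa>[OF that] \<rho>[OF that] \<rho>_nz[OF that]
    by (simp add: has_real_derivative_iff_has_vector_derivative)
  have m'_cont: "continuous_on {0..1} m'"
    unfolding m'_def using \<rho>_nz by (intro continuous_intros \<kappa>_cont \<rho>_cont cont) auto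
  have m_cont: "continuous_on {0..1} m"
    unfolding m_def using \<rho>_nz by (intro continuous_intros \<kappa>_cont \<rho>_cont) auto
  have g: "(g has_vector_derivative g' t) (at t within {0..1})" if "t \<in> {0..1}" for t
    unfolding g_def g'_def using has_vector_derivative_mult[OF has_vector_derivative_of_real[where 'a = complex] h[OF that], of m "m' t"]
      m[OF that]
    by (simp add: has_real_derivative_iff_has_vector_derivative add.commute)
  have g'_cont: "continuous_on {0..1} g'"
    unfolding g'_def by (intro continuous_intros m_cont m'_cont \<Phi>_cont \<kappa>_cont)
  have "2 * pi * \<i> * of_int n * coef ?h n = coef (\<lambda>t. 2 * pi * \<i> * of_real (\<kappa> t) * ?h t / of_real (\<rho> t)) n"
    by (intro coef_by_parts h per continuous_intros \<Phi>_cont \<kappa>_cont)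
  also have "\<dots> = 2 * pi * \<i> * coef g n"
    unfolding coef_cmult[symmetric] g_def m_def by (intro coef_cong) simp
  finally have 1: "of_int n * coef ?h n = coef g n"
    by (simp add: mult.assoc)
  have 2: "2 * pi * \<i> * of_int n * coef g n = coef (\<lambda>t. g' t / of_real (\<rho> t)) n"
  proof (rule coef_by_parts[OF g g'_cont])
    show "g 0 = g 1" unfolding g_def m_def per ..
  qed
  \<comment> \<open>The three terms come from differentiating \<open>\<kappa>\<close>, the
    denominator \<open>\<rho>\<close> and the exponential, each divided by \<open>\<rho>\<close>
    once more.\<close>
  define K where "K = Y / c^2 + X * R / c^3 + 2 * pi * X^2 / c^2"
  have "0 \<le> X" "0 \<le> Y" "0 \<le> R"
    using X[of 0] Y[of 0] R[of 0] by auto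
  have "norm (coef (\<lambda>t. g' t / of_real (\<rho> t)) n) \<le> K"
  proof (rule norm_coef_le)
    show "continuous_on {0..1} (\<lambda>t. g' t / of_real (\<rho> t))"
      using \<rho>_nz by (intro continuous_intros g'_cont \<rho>_cont) auto
    fix t :: real assume t: "t \<in> {0..1}"
    have *: "\<bar>\<rho> t\<bar> = \<rho> t" "\<rho> t > 0" using \<rho>_pos[OF t] by auto
    have "norm (g' t) \<le> \<bar>m' t\<bar> + \<bar>m t\<bar> * (2 * pi * \<bar>\<kappa> t\<bar>)"
      unfolding g'_def by (rule norm_triangle_le) (simp add: norm_mult)
    also have "\<bar>m' t\<bar> \<le> \<bar>\<kappa>' t\<bar> / \<rho> t + \<bar>\<kappa> t\<bar> * \<bar>\<rho>' t\<bar> / (\<rho> t)^2"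
    proof -
      have "m' t = \<kappa>' t / \<rho> t - \<kappa> t * \<rho>' t / (\<rho> t)^2"
        unfolding m'_def using * by (simp add: field_simps power2_eq_square)
      then show ?thesis
        using abs_triangle_ineq4[of "\<kappa>' t / \<rho> t" "\<kappa> t * \<rho>' t / (\<rho> t)^2"] *
        by (simp add: abs_mult)
    qed
    also have "\<bar>m t\<bar> * (2 * pi * \<bar>\<kappa> t\<bar>) = 2 * pi * \<bar>\<kappa> t\<bar>^2 / \<rho> t"
      using * by (simp add: m_def power2_eq_square)
    finally have "norm (g' t) / \<rho> t \<le>
        (\<bar>\<kappa>' t\<bar> / \<rho> t + \<bar>\<kappa> t\<bar> * \<bar>\<rho>' t\<bar> / (\<rho> t)^2 + 2 * pi * \<bar>\<kappa> t\<bar>^2 / \<rho> t) / \<rho> t"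
      using * by (simp add: divide_right_mono)
    also have "\<dots> = \<bar>\<kappa>' t\<bar> / (\<rho> t)^2 + \<bar>\<kappa> t\<bar> * \<bar>\<rho>' t\<bar> / (\<rho> t)^3 + 2 * pi * \<bar>\<kappa> t\<bar>^2 / (\<rho> t)^2"
      using * by (simp add: field_simps power2_eq_square power3_eq_cube)
    also have "\<dots> \<le> K"
      unfolding K_def using X[OF t] Y[OF t] R[OF t] c(1) c(2)[OF t] \<open>0 \<le> X\<close> \<open>0 \<le> Y\<close> \<open>0 \<le> R\<close>
      by (intro add_mono frac_le mult_mono power_mono) auto
    finally show "norm (g' t / of_real (\<rho> t)) \<le> K"
      using * by (simp add: norm_divide)
  qed
  then have "2 * pi * \<bar>of_int n\<bar> * norm (coef g n) \<le> K"
    unfolding 2[symmetric] by (simp add: norm_mult)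
  moreover have "norm (coef g n) = \<bar>of_int n\<bar> * norm (coef ?h n)"
    unfolding 1[symmetric] by (simp add: norm_mult)
  ultimately have "2 * pi * (\<bar>of_int n\<bar> * \<bar>of_int n\<bar> * norm (coef ?h n)) \<le> K"
    by (simp add: mult_ac)
  \<comment> \<open>One factor \<open>2 \<pi>\<close> of the two integrations has cancelled against
    that of the first derivative; the other is simply dropped.\<close>
  moreover have "1 * (\<bar>of_int n\<bar> * \<bar>of_int n\<bar> * norm (coef ?h n)) \<le> 2 * pi * (\<bar>of_int n\<bar> * \<bar>of_int n\<bar> * norm (coef ?h n))"
    using pi_gt3 by (intro mult_right_mono) auto
  ultimately have "norm (coef ?h n) * (real_of_int n)^2 \<le> K"
    by (simp add: power2_eq_square mult_ac)
  then show ?thesis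
    unfolding K_def[symmetric] using n by (simp add: field_simps)
qed

end

subsection \<open>Trigonometric polynomials\<close>

definition trig_poly :: "nat \<Rightarrow> (int \<Rightarrow> complex) \<Rightarrow> real \<Rightarrow> complex" where
  "trig_poly M c t = (\<Sum>k\<in>{- int M..int M}. c k * expi (of_int k * t))"

definition coef_sum_norm :: "nat \<Rightarrow> (int \<Rightarrow> complex) \<Rightarrow> real" where
  "coef_sum_norm M c = (\<Sum>k\<in>{- int M..int M}. norm (c k))"

definition deriv_coefs :: "(int \<Rightarrow> complex) \<Rightarrow> int \<Rightarrow> complex" where
  "deriv_coefs c k = 2 * pi * \<i> * of_int k * c k"

lemma trig_space_eq: "trig_space M = range (trig_poly M)"
  by (auto simp: trig_space_def trig_poly_def fun_eq_iff image_iff)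

lemma trig_poly_has_vector_derivative:
  "(trig_poly M c has_vector_derivative trig_poly M (deriv_coefs c) t) (at t within A)"
proof -
  have "((\<lambda>t. c k * expi (of_int k * t)) has_vector_derivative
      deriv_coefs c k * expi (of_int k * t)) (at t within A)" for k
  proof -
    have "((\<lambda>t. of_int k * t) has_vector_derivative of_int k * 1) (at t within A)"
      by (intro has_vector_derivative_mult_right has_vector_derivative_id)
    from has_vector_derivative_mult_right[OF expi_has_vector_derivative[OF this], of "c k"]
    show ?thesis by (simp add: deriv_coefs_def mult_ac)
  qed
  then show ?thesis
    unfolding trig_poly_def by (intro has_vector_derivative_sum)
qed

lemma trig_poly_cont: "continuous_on A (trig_poly M c)"
  unfolding trig_poly_def by (intro continuous_intros)

lemma trig_poly_periodic: "trig_poly M c 0 = trig_poly M c 1"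
  by (simp add: trig_poly_def)

lemma norm_trig_poly_le: "norm (trig_poly M c t) \<le> coef_sum_norm M c"
  unfolding trig_poly_def coef_sum_norm_def by (rule sum_norm_le) (simp add: norm_mult)

lemma coef_sum_norm_nonneg: "0 \<le> coef_sum_norm M c"
  unfolding coef_sum_norm_def by (simp add: sum_nonneg)

lemma coef_sum_norm_deriv_coefs_le: "coef_sum_norm M (deriv_coefs c) \<le> 2 * pi * M * coef_sum_norm M c"
  unfolding coef_sum_norm_def sum_distrib_left
proof (rule sum_mono)
  fix k assume "k \<in> {- int M..int M}"
  then have "\<bar>real_of_int k\<bar> \<le> real M" by auto
  then show "norm (deriv_coefs c k) \<le> 2 * pi * M * norm (c k)"
    by (simp add: deriv_coefs_def norm_mult mult_left_mono mult_right_mono)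
qed

lemma Re_trig_poly_has_vector_derivative:
  "((\<lambda>t. Re (trig_poly M c t)) has_vector_derivative Re (trig_poly M (deriv_coefs c) t)) (at t within A)"
  by (rule bounded_linear.has_vector_derivative[OF bounded_linear_Re, OF trig_poly_has_vector_derivative])

lemma trig_poly_add: "trig_poly M (\<lambda>k. c k + d k) t = trig_poly M c t + trig_poly M d t"
  by (simp add: trig_poly_def distrib_right sum.distrib)

lemma trig_poly_diff: "trig_poly M (\<lambda>k. c k - d k) t = trig_poly M c t - trig_poly M d t"
  by (simp add: trig_poly_def left_diff_distrib sum_subtractf)

lemma trig_poly_cmult: "trig_poly M (\<lambda>k. a * c k) t = a * trig_poly M c t"
  by (simp add: trig_poly_def sum_distrib_left mult.assoc)

interpretation id_phase: unit_phase "\<lambda>t. t" "\<lambda>t. 1"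
  by unfold_locales (auto intro: has_vector_derivative_id)

lemma fourier_eq_coef: "fourier g k = id_phase.coef (\<lambda>t. of_real (g t)) k"
  by (simp add: fourier_def id_phase.coef_def)

lemma coef_trig_poly:
  "id_phase.coef (trig_poly M c) k = (if k \<in> {- int M..int M} then c k else 0)"
  unfolding trig_poly_def
  by (subst id_phase.coef_sum)
     (auto simp: id_phase.coef_cmult id_phase.coef_expi if_distrib cong: if_cong intro!: continuous_intros)

lemma l1_norm_finite_support:
  assumes "\<And>k. k \<notin> {- int M..int M} \<Longrightarrow> c k = 0"
  shows "l1_norm c = ennreal (coef_sum_norm M c)"
proof -
  have "l1_norm c = (\<Sum>\<^sub>\<infinity>k\<in>{- int M..int M}. ennreal (norm (c k)))"
    unfolding l1_norm_def by (rule infsum_cong_neutral) (use assms in auto)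
  then show ?thesis by (simp add: coef_sum_norm_def sum_ennreal)
qed

lemma deriv01_eqI:
  "(g has_vector_derivative d) (at t within {0..1}) \<Longrightarrow> t \<in> {0..1} \<Longrightarrow> deriv01 g t = d"
  unfolding deriv01_def by (rule vector_derivative_within_closed_interval) auto

text \<open>The coefficients are complex; the vanishing imaginary part on the unit interval is what
  identifies them with the Fourier coefficients of the derivative.\<close>

definition trig_deriv :: "nat \<Rightarrow> (int \<Rightarrow> complex) \<Rightarrow> (real \<Rightarrow> real) \<Rightarrow> bool" where
  "trig_deriv M c \<phi> \<longleftrightarrow> (\<forall>t\<in>{0..1}.
     (\<phi> has_vector_derivative Re (trig_poly M c t)) (at t within {0..1}) \<and> Im (trig_poly M c t) = 0)"

lemma trig_derivD:
  assumes "trig_deriv M c \<phi>" "t \<in> {0..1}"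
  shows "(\<phi> has_vector_derivative Re (trig_poly M c t)) (at t within {0..1})"
    "of_real (Re (trig_poly M c t)) = trig_poly M c t"
    "deriv01 \<phi> t = Re (trig_poly M c t)"
  using assms by (auto simp: trig_deriv_def complex_eq_iff intro: deriv01_eqI)

lemma has_deriv_in_trig_space_iff: "has_deriv_in_trig_space M \<phi> \<longleftrightarrow> (\<exists>c. trig_deriv M c \<phi>)"
proof
  assume "has_deriv_in_trig_space M \<phi>"
  then obtain c where c: "\<And>t. t \<in> {0..1} \<Longrightarrow>
      ((\<lambda>s. complex_of_real (\<phi> s)) has_vector_derivative trig_poly M c t) (at t within {0..1})"
    unfolding has_deriv_in_trig_space_def trig_space_eq by blast
  have "Im (trig_poly M c t) = 0" if "t \<in> {0..1}" for t
    using bounded_linear.has_vector_derivative[OF bounded_linear_Im, OF c[OF that]] that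
      vector_derivative_unique_within_closed_interval[of 0 1 t "\<lambda>_. 0" _ 0] by fastforce
  moreover have "(\<phi> has_vector_derivative Re (trig_poly M c t)) (at t within {0..1})"
    if "t \<in> {0..1}" for t
    using bounded_linear.has_vector_derivative[OF bounded_linear_Re, OF c[OF that]] by simp
  ultimately show "\<exists>c. trig_deriv M c \<phi>" unfolding trig_deriv_def by blast
next
  assume "\<exists>c. trig_deriv M c \<phi>"
  then obtain c where c: "trig_deriv M c \<phi>" ..
  show "has_deriv_in_trig_space M \<phi>"
    unfolding has_deriv_in_trig_space_def trig_space_eq
  proof (intro bexI ballI)
    fix t :: real assume t: "t \<in> {0..1}"
    show "((\<lambda>s. complex_of_real (\<phi> s)) has_vector_derivative trig_poly M c t) (at t within {0..1})"
      using has_vector_derivative_of_real[where 'a = complex,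
          OF trig_derivD(1)[OF c t, folded has_real_derivative_iff_has_vector_derivative]]
      by (simp only: trig_derivD(2)[OF c t])
  qed auto
qed

lemma trig_deriv_cong:
  assumes "trig_deriv M c \<phi>" "\<And>t. t \<in> {0..1} \<Longrightarrow> \<phi> t = \<psi> t"
  shows "trig_deriv M c \<psi>"
  unfolding trig_deriv_def
proof (intro ballI conjI)
  fix t :: real assume t: "t \<in> {0..1}"
  show "(\<psi> has_vector_derivative Re (trig_poly M c t)) (at t within {0..1})"
    by (rule has_vector_derivative_transform[OF t _ trig_derivD(1)[OF assms(1) t]]) (simp add: assms(2))
  show "Im (trig_poly M c t) = 0" using assms(1) t by (simp add: trig_deriv_def)
qed

lemma trig_deriv_diff:
  "trig_deriv M c \<phi> \<Longrightarrow> trig_deriv M d \<psi> \<Longrightarrow> trig_deriv M (\<lambda>k. c k - d k) (\<lambda>t. \<phi> t - \<psi> t)"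
  by (auto simp: trig_deriv_def trig_poly_diff intro: has_vector_derivative_diff)

lemma trig_deriv_add:
  "trig_deriv M c \<phi> \<Longrightarrow> trig_deriv M d \<psi> \<Longrightarrow> trig_deriv M (\<lambda>k. c k + d k) (\<lambda>t. \<phi> t + \<psi> t)"
  by (auto simp: trig_deriv_def trig_poly_add intro: has_vector_derivative_add)

lemma trig_deriv_cmult:
  "trig_deriv M c \<phi> \<Longrightarrow> trig_deriv M (\<lambda>k. of_real a * c k) (\<lambda>t. a * \<phi> t)"
  by (auto simp: trig_deriv_def trig_poly_cmult intro: has_vector_derivative_mult_right)

lemma coef_sum_norm_add_le: "coef_sum_norm M (\<lambda>k. c k + d k) \<le> coef_sum_norm M c + coef_sum_norm M d"
  unfolding coef_sum_norm_def sum.distrib[symmetric] by (intro sum_mono norm_triangle_ineq)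

lemma coef_sum_norm_cmult: "coef_sum_norm M (\<lambda>k. of_real a * c k) = \<bar>a\<bar> * coef_sum_norm M c"
  by (simp add: coef_sum_norm_def sum_distrib_left norm_mult)

lemma trig_deriv_const_diff:
  "trig_deriv M c \<phi> \<Longrightarrow> trig_deriv M c (\<lambda>t. \<phi> t - b)"
  using has_vector_derivative_diff_const[of \<phi> b] by (simp add: trig_deriv_def)

lemma fourier_deriv01_trig_deriv:
  assumes "trig_deriv M c \<phi>"
  shows "fourier (deriv01 \<phi>) k = (if k \<in> {- int M..int M} then c k else 0)"
proof -
  have "fourier (deriv01 \<phi>) k = id_phase.coef (trig_poly M c) k"
    unfolding fourier_eq_coef
    by (rule id_phase.coef_cong) (use trig_derivD[OF assms] in simp)
  then show ?thesis by (simp add: coef_trig_poly)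
qed

lemma phase_err_trig_deriv:
  assumes "trig_deriv M c (\<lambda>t. \<phi> t - \<theta> t)"
  shows "phase_err \<phi> \<theta> = ennreal (coef_sum_norm M c)"
proof -
  have "phase_err \<phi> \<theta> = l1_norm (\<lambda>k. if k \<in> {- int M..int M} then c k else 0)"
    unfolding phase_err_def using fourier_deriv01_trig_deriv[OF assms] by presburger
  also have "\<dots> = ennreal (coef_sum_norm M (\<lambda>k. if k \<in> {- int M..int M} then c k else 0))"
    by (rule l1_norm_finite_support) auto
  also have "coef_sum_norm M (\<lambda>k. if k \<in> {- int M..int M} then c k else 0) = coef_sum_norm M c"
    by (simp add: coef_sum_norm_def)
  finally show ?thesis .
qed

subsection \<open>A phase and its approximation\<close>

lemma abs_Re_trig_poly_le: "\<bar>Re (trig_poly M c t)\<bar> \<le> coef_sum_norm M c"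
  using abs_Re_le_cmod[of "trig_poly M c t"] norm_trig_poly_le[of M c t] by simp

lemma trig_deriv_increment_le:
  assumes "trig_deriv M c g"
  shows "\<bar>g 1 - g 0\<bar> \<le> coef_sum_norm M c"
proof -
  have "((\<lambda>t. Re (trig_poly M c t)) has_integral g 1 - g 0) {0..1}"
    by (intro fundamental_theorem_of_calculus trig_derivD(1)[OF assms]) auto
  then have "norm (g 1 - g 0) \<le> coef_sum_norm M c * measure lborel (cbox 0 (1::real))"
    using abs_Re_trig_poly_le by (intro has_integral_bound coef_sum_norm_nonneg) auto
  then show ?thesis by simp
qed

text \<open>The phase \<open>\<theta>\<close> of the signal with normalisation \<open>\<sigma>\<close>, and an approximate phase \<open>\<phi>\<close>.\<close>

locale phase_pair =
  fixes M :: nat and \<sigma> \<phi> \<theta> :: "real \<Rightarrow> real" and w q :: "int \<Rightarrow> complex"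
    and L L' :: int and c0 E0 :: real
  assumes w: "trig_deriv M w \<sigma>" and \<sigma>_0: "\<sigma> 0 = 0" and \<sigma>_1: "\<sigma> 1 = 1"
    and c0: "c0 > 0" "\<And>t. t \<in> {0..1} \<Longrightarrow> c0 \<le> Re (trig_poly M w t)"
    and \<theta>_eq: "\<And>t. t \<in> {0..1} \<Longrightarrow> \<theta> t = \<theta> 0 + 2 * pi * of_int L * \<sigma> t"
    and q: "trig_deriv M q (\<lambda>t. \<theta> t - \<phi> t)"
    and L'_eq: "\<phi> 1 - \<phi> 0 = 2 * pi * of_int L'"
    and E0: "coef_sum_norm M q \<le> E0"
    and L: "8 \<le> L" "E0 \<le> of_int L" "E0 \<le> c0 * of_int L"
begin

definition E where "E = coef_sum_norm M q"
definition A where "A = coef_sum_norm M w"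
definition \<psi> where "\<psi> t = \<theta> t - \<phi> t"
definition s where "s t = (\<phi> t - \<phi> 0) / (2 * pi * of_int L')"
text \<open>Coefficients of the derivative of \<open>s\<close>, from
  \<open>\<phi>' = 2 \<pi> L \<sigma>' - (\<theta> - \<phi>)'\<close> divided by
  \<open>2 \<pi> L'\<close>.\<close>

definition r :: "int \<Rightarrow> complex" where
  "r = (\<lambda>k. of_real (1 / (2 * pi * of_int L')) * (of_real (2 * pi * of_int L) * w k - q k))"
definition \<rho> where "\<rho> t = Re (trig_poly M r t)"

lemma E_nonneg: "0 \<le> E" and A_nonneg: "0 \<le> A"
  by (simp_all add: E_def A_def coef_sum_norm_nonneg)

lemma \<psi>_deriv: "trig_deriv M q \<psi>"
  using q by (simp add: \<psi>_def[abs_def])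

lemma L'_diff: "\<bar>of_int L - of_int L'\<bar> * (2 * pi) \<le> E"
proof -
  have "(\<theta> 1 - \<phi> 1) - (\<theta> 0 - \<phi> 0) = 2 * pi * (of_int L - of_int L')"
    using \<theta>_eq[of 1] L'_eq \<sigma>_1 by (simp add: algebra_simps)
  with trig_deriv_increment_le[OF q] show ?thesis
    by (simp add: E_def abs_mult mult.commute)
qed

text \<open>The increment of \<open>\<theta> - \<phi>\<close> over the interval is
  \<open>2 \<pi> (L - L')\<close> and at most \<open>E \<le> L\<close>; weakening
  \<open>2 \<pi>\<close> to 4 gives the simple fractions that position the pass band.\<close>

lemma L'_bounds: "3 / 4 * of_int L \<le> (of_int L' :: real)" "of_int L' \<le> (5 / 4 * of_int L :: real)"
proof -
  have "\<bar>of_int L - of_int L'\<bar> * 4 \<le> \<bar>of_int L - of_int L'\<bar> * (2 * pi)"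
    using pi_gt3 by (intro mult_left_mono) auto
  with L'_diff E0 L have "\<bar>of_int L - of_int L'\<bar> * 4 \<le> (of_int L :: real)"
    unfolding E_def by linarith
  then have "\<bar>of_int L - of_int L'\<bar> \<le> (of_int L / 4 :: real)"
    by simp
  then show "3 / 4 * of_int L \<le> (of_int L' :: real)" "of_int L' \<le> (5 / 4 * of_int L :: real)"
    unfolding abs_le_iff by simp_all
qed

lemma L_pos: "(of_int L :: real) \<ge> 8" "(of_int L' :: real) > 0" "L' > 0"
proof -
  show 1: "(of_int L :: real) \<ge> 8" using L(1) by linarith
  show "(of_int L' :: real) > 0" using 1 L'_bounds(1) by linarith
  then show "L' > 0" by simp
qed

lemma num_periods_\<phi>: "num_periods \<phi> = of_int L'"
  using L'_eq by (simp add: num_periods_def)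

lemma norm_phase_\<phi>: "norm_phase \<phi> = s"
  by (simp add: fun_eq_iff norm_phase_def num_periods_\<phi> s_def)

lemma s_trig_deriv: "trig_deriv M r s"
proof -
  have "trig_deriv M r (\<lambda>t. 1 / (2 * pi * of_int L') * (2 * pi * of_int L * \<sigma> t - (\<theta> t - \<phi> t)))"
    unfolding r_def by (intro trig_deriv_cmult trig_deriv_diff w q)
  then have "trig_deriv M r (\<lambda>t. 1 / (2 * pi * of_int L') * (2 * pi * of_int L * \<sigma> t - (\<theta> t - \<phi> t))
      - (\<phi> 0 - \<theta> 0) / (2 * pi * of_int L'))"
    by (rule trig_deriv_const_diff)
  then show ?thesis
  proof (rule trig_deriv_cong)
    fix t :: real assume "t \<in> {0..1}"
    then show "1 / (2 * pi * of_int L') * (2 * pi * of_int L * \<sigma> t - (\<theta> t - \<phi> t))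
        - (\<phi> 0 - \<theta> 0) / (2 * pi * of_int L') = s t"
      unfolding s_def using \<theta>_eq[of t] L_pos by (simp add: field_simps)
  qed
qed

lemma \<rho>_eq: "\<rho> t = (of_int L * Re (trig_poly M w t)) / of_int L' - Re (trig_poly M q t) / (2 * pi * of_int L')"
  unfolding \<rho>_def r_def trig_poly_cmult trig_poly_diff using L_pos
  by (simp add: field_simps)

text \<open>In \<open>\<rho>_eq\<close> the main term is at least \<open>4/5 c0\<close>, because
  \<open>L / L' \<ge> 4/5\<close>, and the perturbation is at most \<open>3/10 c0\<close>.\<close>

lemma \<rho>_ge:
  assumes "t \<in> {0..1}"
  shows "c0 / 2 \<le> \<rho> t"
proof -
  have "c0 * (4 / 5) \<le> Re (trig_poly M w t) * (of_int L / of_int L')"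
    using c0(1) c0(2)[OF assms] L'_bounds L_pos by (intro mult_mono) (auto simp: field_simps)
  moreover have "Re (trig_poly M q t) / (2 * pi * of_int L') \<le> c0 * (3 / 10)"
  proof -
    have "Re (trig_poly M q t) \<le> c0 * of_int L"
      using abs_Re_trig_poly_le[of M q t] E0 L by linarith
    also have "\<dots> \<le> c0 * (3 / 10) * (2 * 3 * of_int L')"
      using c0 L'_bounds L_pos by simp
    also have "\<dots> \<le> c0 * (3 / 10) * (2 * pi * of_int L')"
      using c0 L_pos pi_gt3 by (intro mult_left_mono mult_right_mono) auto
    finally show ?thesis using L_pos by (simp add: field_simps)
  qed
  ultimately show ?thesis unfolding \<rho>_eq by (simp add: mult.commute)
qed

sublocale P: unit_phase s \<rho>
proof
  fix t :: real assume t: "t \<in> {0..1}"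
  show "(s has_vector_derivative \<rho> t) (at t within {0..1})"
    unfolding \<rho>_def by (rule trig_derivD(1)[OF s_trig_deriv t])
  show "\<rho> t > 0" using \<rho>_ge[OF t] c0(1) by simp
next
  show "continuous_on {0..1} \<rho>"
    unfolding \<rho>_def by (intro continuous_intros trig_poly_cont)
  show "s 0 = 0" by (simp add: s_def)
  show "s 1 = 1" using L'_eq L_pos by (simp add: s_def)
qed

sublocale S: unit_phase \<sigma> "\<lambda>t. Re (trig_poly M w t)"
proof
  fix t :: real assume t: "t \<in> {0..1}"
  show "(\<sigma> has_vector_derivative Re (trig_poly M w t)) (at t within {0..1})"
    by (rule trig_derivD(1)[OF w t])
  show "Re (trig_poly M w t) > 0" using c0(1) c0(2)[OF t] by simp
qed (intro continuous_intros trig_poly_cont, rule \<sigma>_0, rule \<sigma>_1)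

text \<open>A frequency \<open>k\<close> in the coordinate \<open>\<sigma>\<close> is the frequency \<open>k\<close> in the coordinate \<open>s\<close> up to the
  slowly varying factor \<open>expi (mod_phase k 0 t)\<close>, whose derivatives are of order \<open>E\<close> as long as
  \<open>k\<close> is at most of order \<open>L\<close>.\<close>

definition mod_phase :: "int \<Rightarrow> int \<Rightarrow> real \<Rightarrow> real" where
  "mod_phase k e t = of_int k * (\<sigma> t - s t) + of_int e * (\<psi> t / (2 * pi))"

definition mod_coefs :: "int \<Rightarrow> int \<Rightarrow> int \<Rightarrow> complex" where
  "mod_coefs k e = (\<lambda>j. of_real (of_int k) * (w j - r j) + of_real (of_int e / (2 * pi)) * q j)"

text \<open>The bound of \<open>norm_coef_expi_le\<close> with \<open>c = c0 / 2\<close>,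
  \<open>X = E (A + 2)\<close>, \<open>Y = 2 \<pi> M X\<close> and
  \<open>R = 2 \<pi> M (2 A + 1)\<close>, after taking out a factor \<open>E\<close>. In the
  quadratic term the second \<open>E\<close> is replaced by \<open>E0\<close>, so that nothing
  depends on \<open>L\<close> or on the current phase.\<close>

definition B :: real where
  "B = (A + 2) * (2 * pi * M / (c0 / 2)^2 + 2 * pi * M * (2 * A + 1) / (c0 / 2)^3
        + 2 * pi * (E0 * (A + 2)) / (c0 / 2)^2)"

lemma E0_nonneg: "0 \<le> E0"
  using E_nonneg E0 by (simp add: E_def)

lemma B_nonneg: "0 \<le> B"
  unfolding B_def using A_nonneg c0 E0_nonneg by (intro mult_nonneg_nonneg add_nonneg_nonneg) auto

lemma mod_phase_trig_deriv: "trig_deriv M (mod_coefs k e) (mod_phase k e)"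
proof -
  have "trig_deriv M (mod_coefs k e) (\<lambda>t. of_int k * (\<sigma> t - s t) + of_int e / (2 * pi) * \<psi> t)"
    unfolding mod_coefs_def
    by (intro trig_deriv_add trig_deriv_cmult trig_deriv_diff w s_trig_deriv \<psi>_deriv)
  then show ?thesis
    by (rule trig_deriv_cong) (simp add: mod_phase_def)
qed

text \<open>Inserting \<open>r\<close> turns \<open>w - r\<close> into \<open>(L' - L) / L'\<close>
  times \<open>w\<close> plus \<open>q / (2 \<pi> L')\<close>. Both are of order
  \<open>E / L\<close>, which compensates a factor \<open>k\<close> of size up to \<open>L\<close>;
  the two multiples of \<open>q\<close> have factors at most 1 each, whence the 2.\<close>

lemma mod_coefs_le:
  assumes k: "\<bar>k\<bar> \<le> L" and e: "\<bar>e\<bar> \<le> 1"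
  shows "coef_sum_norm M (mod_coefs k e) \<le> E * (A + 2)"
proof -
  have Lb: "(of_int L' :: real) > 0" "of_int L' \<ge> (3 / 4 * of_int L :: real)" "(of_int L :: real) > 0"
    using L_pos L'_bounds by auto
  have k': "\<bar>of_int k\<bar> \<le> (of_int L :: real)" and e': "\<bar>of_int e\<bar> \<le> (1 :: real)"
    using k e by linarith+
  have "mod_coefs k e = (\<lambda>j. of_real (of_int k * (of_int L' - of_int L) / of_int L') * w j
      + of_real (of_int k / (2 * pi * of_int L') + of_int e / (2 * pi)) * q j)"
    unfolding mod_coefs_def r_def using Lb by (simp add: fun_eq_iff field_simps)
  then have "coef_sum_norm M (mod_coefs k e) \<le>
      \<bar>of_int k * (of_int L' - of_int L) / of_int L'\<bar> * A
      + \<bar>of_int k / (2 * pi * of_int L') + of_int e / (2 * pi)\<bar> * E"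
    using coef_sum_norm_add_le[of M "\<lambda>j. of_real (of_int k * (of_int L' - of_int L) / of_int L') * w j"]
    unfolding A_def E_def coef_sum_norm_cmult[symmetric] by metis
  also have "\<dots> \<le> E * A + 2 * E"
  proof (intro add_mono mult_right_mono A_nonneg E_nonneg)
    have "\<bar>of_int k\<bar> * \<bar>of_int L' - of_int L\<bar> \<le> of_int L * (E / 4)"
    proof (intro mult_mono k')
      have "\<bar>of_int L - of_int L'\<bar> * 4 \<le> \<bar>of_int L - of_int L'\<bar> * (2 * pi)"
        using pi_gt3 by (intro mult_left_mono) auto
      with L'_diff have "\<bar>of_int L - of_int L'\<bar> * 4 \<le> E" by (rule order_trans[rotated])
      then show "\<bar>of_int L' - of_int L\<bar> \<le> E / 4" by (simp add: abs_minus_commute)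
    qed (use Lb in auto)
    also have "\<dots> = E * (1 / 4 * of_int L)"
      by simp
    also have "\<dots> \<le> E * of_int L'"
      using Lb by (intro mult_left_mono E_nonneg) linarith
    finally show "\<bar>of_int k * (of_int L' - of_int L) / of_int L'\<bar> \<le> E"
      unfolding abs_mult abs_divide using Lb(1) by (simp add: pos_divide_le_eq)
    have "\<bar>of_int k / (2 * pi * of_int L')\<bar> \<le> 1"
    proof -
      have "\<bar>of_int k\<bar> \<le> 4 / 3 * (of_int L' :: real)" using k' Lb by linarith
      also have "\<dots> \<le> 2 * pi * of_int L'" using pi_gt3 Lb by (intro mult_right_mono) auto
      finally show ?thesis using Lb by (simp add: abs_mult)
    qed
    moreover have "\<bar>of_int e / (2 * pi)\<bar> \<le> (1 :: real)"
      using e' pi_gt3 by (simp add: abs_mult)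
    ultimately show "\<bar>of_int k / (2 * pi * of_int L') + of_int e / (2 * pi)\<bar> \<le> 2"
      by linarith
  qed
  finally show ?thesis by (simp add: algebra_simps)
qed

lemma r_le: "coef_sum_norm M r \<le> 2 * A + 1"
proof -
  have Lb: "(of_int L' :: real) > 0" "of_int L' \<ge> (3 / 4 * of_int L :: real)" "(of_int L :: real) > 0"
    using L_pos L'_bounds by auto
  have "r = (\<lambda>k. of_real (of_int L / of_int L') * w k + of_real (- 1 / (2 * pi * of_int L')) * q k)"
    unfolding r_def using Lb by (simp add: fun_eq_iff field_simps)
  then have "coef_sum_norm M r \<le> \<bar>of_int L / of_int L'\<bar> * A + \<bar>- 1 / (2 * pi * of_int L')\<bar> * E"
    using coef_sum_norm_add_le[of M "\<lambda>k. of_real (of_int L / of_int L') * w k"]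
    unfolding A_def E_def coef_sum_norm_cmult[symmetric] by metis
  also have "\<dots> \<le> 2 * A + 1"
  proof (intro add_mono mult_right_mono A_nonneg)
    show "\<bar>of_int L / of_int L'\<bar> \<le> (2 :: real)"
      using Lb by (simp add: field_simps)
    have "E \<le> of_int L" using E0 L(2) by (simp add: E_def)
    also have "\<dots> \<le> 4 / 3 * of_int L'" using Lb by linarith
    also have "\<dots> \<le> 2 * pi * of_int L'" using pi_gt3 Lb by (intro mult_right_mono) auto
    finally show "\<bar>- 1 / (2 * pi * of_int L')\<bar> * E \<le> 1"
      using Lb by (simp add: field_simps)
  qed
  finally show ?thesis .
qed

text \<open>Both phases make a whole number of turns, so \<open>\<psi>\<close> changes by a multiple
  of \<open>2 \<pi>\<close>. This makes the modulating factors periodic, as quadratic decay of their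
  coefficients requires.\<close>

lemma \<psi>_periodic: "expi (of_int e * (\<psi> 0 / (2 * pi))) = expi (of_int e * (\<psi> 1 / (2 * pi)))"
proof -
  have "\<psi> 1 = \<psi> 0 + 2 * pi * of_int (L - L')"
    using \<theta>_eq[of 1] L'_eq \<sigma>_1 by (simp add: \<psi>_def algebra_simps)
  then have "of_int e * (\<psi> 1 / (2 * pi)) = of_int e * (\<psi> 0 / (2 * pi)) + of_int (e * (L - L'))"
    by (simp add: add_divide_distrib distrib_left)
  then show ?thesis by (simp only: expi_add expi_of_int mult_1_right)
qed

lemma norm_coef_mod_phase_le:
  assumes k: "\<bar>k\<bar> \<le> L" and e: "\<bar>e\<bar> \<le> 1" and "n \<noteq> 0"
  shows "norm (P.coef (\<lambda>t. expi (mod_phase k e t)) n) \<le> B * E / (real_of_int n)\<^sup>2"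
proof -
  let ?X = "E * (A + 2)" and ?Y = "2 * pi * M * (E * (A + 2))" and ?R = "2 * pi * M * (2 * A + 1)"
  let ?\<kappa> = "\<lambda>t. Re (trig_poly M (mod_coefs k e) t)"
  let ?\<kappa>' = "\<lambda>t. Re (trig_poly M (deriv_coefs (mod_coefs k e)) t)"
  have Xle: "coef_sum_norm M (mod_coefs k e) \<le> ?X" by (rule mod_coefs_le[OF k e])
  have sq: "?X^2 \<le> ?X * (E0 * (A + 2))"
    unfolding power2_eq_square using E0 E_nonneg A_nonneg
    by (intro mult_left_mono mult_right_mono) (auto simp: E_def)
  have "norm (P.coef (\<lambda>t. expi (mod_phase k e t)) n)
     \<le> (?Y / (c0/2)^2 + ?X * ?R / (c0/2)^3 + 2 * pi * ?X^2 / (c0/2)^2) / (real_of_int n)\<^sup>2"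
  proof (rule P.norm_coef_expi_le[where \<kappa> = ?\<kappa> and \<kappa>' = ?\<kappa>' and \<rho>' = "\<lambda>t. Re (trig_poly M (deriv_coefs r) t)"])
    fix t :: real assume t: "t \<in> {0..1}"
    show "(mod_phase k e has_vector_derivative ?\<kappa> t) (at t within {0..1})"
      by (rule trig_derivD(1)[OF mod_phase_trig_deriv t])
    show "(?\<kappa> has_vector_derivative ?\<kappa>' t) (at t within {0..1})"
      by (rule Re_trig_poly_has_vector_derivative)
    show "(\<rho> has_vector_derivative Re (trig_poly M (deriv_coefs r) t)) (at t within {0..1})"
      unfolding \<rho>_def[abs_def] by (rule Re_trig_poly_has_vector_derivative)
    show "c0 / 2 \<le> \<rho> t" by (rule \<rho>_ge[OF t])
    show "\<bar>?\<kappa> t\<bar> \<le> ?X" using abs_Re_trig_poly_le Xle by (rule order_trans)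
    show "\<bar>?\<kappa>' t\<bar> \<le> ?Y"
      by (rule order_trans[OF abs_Re_trig_poly_le order_trans[OF coef_sum_norm_deriv_coefs_le
            mult_left_mono[OF Xle]]]) simp
    show "\<bar>Re (trig_poly M (deriv_coefs r) t)\<bar> \<le> ?R"
      by (rule order_trans[OF abs_Re_trig_poly_le order_trans[OF coef_sum_norm_deriv_coefs_le
            mult_left_mono[OF r_le]]]) simp
  next
    show "expi (mod_phase k e 0) = expi (mod_phase k e 1)"
      using \<psi>_periodic[of e] by (simp add: mod_phase_def \<sigma>_0 \<sigma>_1 P.s_0 P.s_1)
    show "\<rho> 0 = \<rho> 1"
      by (simp add: \<rho>_def trig_poly_periodic)
    show "?\<kappa> 0 = ?\<kappa> 1"
      by (simp add: trig_poly_periodic)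
    show "continuous_on {0..1} ?\<kappa>'" "continuous_on {0..1} (\<lambda>t. Re (trig_poly M (deriv_coefs r) t))"
      by (intro continuous_on_Re trig_poly_cont)+
    show "0 < c0 / 2" "n \<noteq> 0" using c0(1) \<open>n \<noteq> 0\<close> by simp_all
  qed
  also have "(?Y / (c0/2)^2 + ?X * ?R / (c0/2)^3 + 2 * pi * ?X^2 / (c0/2)^2) / (real_of_int n)\<^sup>2
    \<le> (?Y / (c0/2)^2 + ?X * ?R / (c0/2)^3 + 2 * pi * (?X * (E0 * (A + 2))) / (c0/2)^2) / (real_of_int n)\<^sup>2"
    by (intro divide_right_mono add_left_mono mult_left_mono sq) auto
  also have "?Y / (c0/2)^2 + ?X * ?R / (c0/2)^3 + 2 * pi * (?X * (E0 * (A + 2))) / (c0/2)^2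
      = 2 * pi * M / (c0/2)^2 * ?X + ?R / (c0/2)^3 * ?X + 2 * pi * (E0 * (A + 2)) / (c0/2)^2 * ?X"
    by (simp only: times_divide_eq_left times_divide_eq_right mult_ac)
  also have "\<dots> = B * E"
    unfolding B_def distrib_right[symmetric] by (simp only: mult_ac)
  finally show ?thesis .
qed

end

subsection \<open>Low and high frequencies\<close>

context unit_phase
begin

lemma norm_partial_sum_le:
  fixes C :: real
  assumes "continuous_on {0..1} g" "\<And>t. t \<in> {0..1} \<Longrightarrow> norm (g t) \<le> C" "finite W"
  shows "norm (partial_sum g W t) \<le> card W * C"
  unfolding partial_sum_def
  using assms by (intro order_trans[OF sum_norm_le[where g = "\<lambda>_. C"]])
    (auto simp: norm_mult intro: norm_coef_le)

lemma partial_sum_add: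
  "continuous_on {0..1} g \<Longrightarrow> continuous_on {0..1} h \<Longrightarrow>
   partial_sum (\<lambda>t. g t + h t) W t = partial_sum g W t + partial_sum h W t"
  by (simp add: partial_sum_def coef_add distrib_right sum.distrib)

lemma partial_sum_cmult_sum:
  assumes "finite K" "\<And>k. k \<in> K \<Longrightarrow> continuous_on {0..1} (g k)"
  shows "partial_sum (\<lambda>t. \<Sum>k\<in>K. d k * g k t) W t = (\<Sum>k\<in>K. d k * partial_sum (g k) W t)"
proof -
  have "coef (\<lambda>t. \<Sum>k\<in>K. d k * g k t) j = (\<Sum>k\<in>K. d k * coef (g k) j)" for j
    using assms by (subst coef_sum) (auto simp: coef_cmult intro: continuous_on_mult_left)
  then show ?thesis
    by (simp only: partial_sum_def sum_distrib_left sum_distrib_right mult.assoc) (rule sum.swap)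
qed

lemma partial_sum_shift:
  "partial_sum (\<lambda>t. expi (of_int k * s t) * g t) W t
     = expi (of_int k * s t) * partial_sum g ((\<lambda>j. j - k) ` W) t"
proof -
  have "coef g (j - k) * expi (of_int j * s t)
      = expi (of_int k * s t) * (coef g (j - k) * expi (of_int (j - k) * s t))" for j
    by (simp add: mult.left_commute[of _ "coef g (j - k)"] expi_add[symmetric] algebra_simps)
  note shift = this
  show ?thesis
    unfolding partial_sum_def coef_shift shift sum_distrib_left by (simp add: sum.reindex)
qed

lemma sum_norm_coef_le:
  assumes "finite K" "0 \<le> C" "\<And>k. k \<noteq> 0 \<Longrightarrow> norm (coef g k) \<le> C / (real_of_int k)\<^sup>2"
  shows "(\<Sum>k\<in>K. norm (coef g k)) \<le> norm (coef g 0) + 4 * C"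
proof -
  have "(\<Sum>k\<in>K. norm (coef g k)) \<le> norm (coef g 0) + (\<Sum>k\<in>K - {0}. norm (coef g k))"
    using assms(1) by (cases "0 \<in> K") (simp_all add: sum.remove)
  also have "(\<Sum>k\<in>K - {0}. norm (coef g k)) \<le> (\<Sum>k\<in>K - {0}. C * (1 / (real_of_int k)\<^sup>2))"
    using assms(3) by (intro sum_mono) auto
  also have "\<dots> \<le> C * (4 / 1)"
    unfolding sum_distrib_left[symmetric] using assms(1)
    by (intro mult_left_mono assms(2) sum_inverse_squares_int_le) auto
  finally show ?thesis by simp
qed

end

text \<open>Two powers are kept as \<open>1 / x\<^sup>2\<close> to make tails summable, the others
  are evaluated at the cutoff \<open>y\<close>. The tail sum then gains a further
  \<open>1 / L\<close>, which the number of coefficients in the band uses up again.\<close>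

lemma powr_decay_le:
  fixes x y p :: real
  assumes "p \<ge> 2" "0 < y" "y \<le> x"
  shows "x powr (- p) \<le> y powr (- p + 2) / x\<^sup>2"
proof -
  have "x powr (- p) = x powr (- p + 2) / x\<^sup>2"
  proof -
    have "x powr (- p + 2) = x powr (- p) * x powr 2"
      by (rule powr_add)
    also have "x powr 2 = x\<^sup>2"
      using assms by (simp add: powr_numeral)
    finally show ?thesis using assms by simp
  qed
  also have "\<dots> \<le> y powr (- p + 2) / x\<^sup>2"
    using assms by (intro divide_right_mono powr_mono2') auto
  finally show ?thesis .
qed

context phase_pair
begin

text \<open>The value \<open>4 D / J\<close> of \<open>partial_sum_error\<close> at
  \<open>J = L / 4\<close> and \<open>D = C (L / 4) powr (- p + 2)\<close>.\<close>

definition tail_bound :: "real \<Rightarrow> real \<Rightarrow> real" where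
  "tail_bound C p = 16 * (C * (of_int L / 4) powr (- p + 2)) / of_int L"

definition low_freqs :: "int set" where
  "low_freqs = {k. 4 * \<bar>k\<bar> < L}"

definition modulated :: "(real \<Rightarrow> complex) \<Rightarrow> int \<Rightarrow> real \<Rightarrow> complex" where
  "modulated g e t = g t * expi (of_int e * (\<psi> t / (2 * pi)))"

text \<open>Majorant for sums of absolute values of coefficients: the mean stands apart because the
  decay says nothing about it, and \<open>4 C\<close> majorises the sum of
  \<open>C / k\<^sup>2\<close>.\<close>

definition coef_total :: "(real \<Rightarrow> complex) \<Rightarrow> real \<Rightarrow> real" where
  "coef_total g C = norm (S.coef g 0) + 4 * C"

lemma finite_low_freqs: "finite low_freqs"
  by (rule finite_subset[of _ "{- L..L}"]) (auto simp: low_freqs_def)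

lemma \<psi>_cont: "continuous_on {0..1} \<psi>"
  using trig_derivD(1)[OF \<psi>_deriv] by (rule continuous_on_vector_derivative)

lemma mod_phase_cont: "continuous_on {0..1} (mod_phase k e)"
  using trig_derivD(1)[OF mod_phase_trig_deriv] by (rule continuous_on_vector_derivative)

lemma modulated_cont: "continuous_on {0..1} g \<Longrightarrow> continuous_on {0..1} (modulated g e)"
  unfolding modulated_def[abs_def] by (intro continuous_intros \<psi>_cont) simp_all

context
  fixes g :: "real \<Rightarrow> complex" and C p :: real and e :: int
  assumes g_cont: "continuous_on {0..1} g" and C: "0 \<le> C" and p: "4 \<le> p" and e: "\<bar>e\<bar> \<le> 1"
    and decay: "\<And>k. k \<noteq> 0 \<Longrightarrow> norm (S.coef g k) \<le> C * \<bar>real_of_int k\<bar> powr (- p)"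
begin

lemma decay_square:
  assumes "k \<noteq> 0"
  shows "norm (S.coef g k) \<le> C / (real_of_int k)\<^sup>2"
proof -
  have "\<bar>real_of_int k\<bar> powr (- p) \<le> 1 powr (- p + 2) / \<bar>real_of_int k\<bar>\<^sup>2"
    using assms p by (intro powr_decay_le) auto
  from mult_left_mono[OF this C] decay[OF assms] show ?thesis
    by simp
qed

lemma sum_low_coefs_le: "(\<Sum>k\<in>low_freqs. norm (S.coef g k)) \<le> coef_total g C"
  unfolding coef_total_def by (intro S.sum_norm_coef_le finite_low_freqs C decay_square)

lemma low_part_error:
  assumes t: "t \<in> {0..1}"
  shows "norm (g t - S.partial_sum g low_freqs t) \<le> tail_bound C p"
proof -
  let ?D = "C * (of_int L / 4) powr (- p + 2)"
  have "norm (g t - S.partial_sum g low_freqs t) \<le> 4 * ?D / (of_int L / 4)"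
  proof (rule S.partial_sum_error[OF g_cont _ _ _ finite_low_freqs _ t])
    show "1 \<le> (of_int L / 4 :: real)" "0 \<le> ?D" using L_pos(1) C by simp_all
    show "norm (S.coef g j) \<le> ?D / (real_of_int j)\<^sup>2" if j: "of_int L / 4 \<le> \<bar>real_of_int j\<bar>" for j
    proof -
      have "\<bar>real_of_int j\<bar> powr (- p) \<le> (of_int L / 4) powr (- p + 2) / \<bar>real_of_int j\<bar>\<^sup>2"
        using j p L_pos(1) by (intro powr_decay_le) auto
      moreover have "j \<noteq> 0" using j L_pos(1) by auto
      ultimately show ?thesis
        using mult_left_mono[OF _ C] decay[of j] by fastforce
    qed
    show "{j. \<bar>real_of_int j\<bar> < of_int L / 4} \<subseteq> low_freqs"
    proof
      fix j :: int assume "j \<in> {j. \<bar>real_of_int j\<bar> < of_int L / 4}"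
      then have "real_of_int (4 * \<bar>j\<bar>) < of_int L" by simp
      then show "j \<in> low_freqs" unfolding low_freqs_def of_int_less_iff by simp
    qed
  qed
  then show ?thesis by (simp add: tail_bound_def)
qed

text \<open>The modulated low part of \<open>g\<close>, expressed through frequencies of
  \<open>s\<close>: the exponent \<open>k s\<close> plus \<open>mod_phase k e\<close> equals
  \<open>k \<sigma> + e \<psi> / (2 \<pi>)\<close>.\<close>

definition mod_low :: "real \<Rightarrow> complex" where
  "mod_low t = (\<Sum>k\<in>low_freqs. S.coef g k * (expi (of_int k * s t) * expi (mod_phase k e t)))"

definition mod_high :: "real \<Rightarrow> complex" where
  "mod_high t = modulated g e t - mod_low t"

lemma shifted_mod_phase_cont: "continuous_on {0..1} (\<lambda>t. expi (of_int k * s t) * expi (mod_phase k e t))"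
  by (intro continuous_intros P.s_cont mod_phase_cont)

lemma mod_low_cont: "continuous_on {0..1} mod_low"
  unfolding mod_low_def[abs_def] by (intro continuous_intros P.s_cont mod_phase_cont)

lemma mod_high_cont: "continuous_on {0..1} mod_high"
  unfolding mod_high_def[abs_def] by (intro continuous_intros modulated_cont g_cont mod_low_cont)

lemma mod_high_le:
  assumes "t \<in> {0..1}"
  shows "norm (mod_high t) \<le> tail_bound C p"
proof -
  have "expi (of_int k * s t) * expi (mod_phase k e t)
      = expi (of_int k * \<sigma> t) * expi (of_int e * (\<psi> t / (2 * pi)))" for k
    unfolding expi_add[symmetric] by (simp add: mod_phase_def algebra_simps)
  then have "mod_low t = S.partial_sum g low_freqs t * expi (of_int e * (\<psi> t / (2 * pi)))"
    by (simp add: mod_low_def S.partial_sum_def sum_distrib_right mult.assoc)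
  then have "mod_high t = (g t - S.partial_sum g low_freqs t) * expi (of_int e * (\<psi> t / (2 * pi)))"
    by (simp add: mod_high_def modulated_def left_diff_distrib)
  then show ?thesis
    using low_part_error[OF assms] by (simp add: norm_mult)
qed

lemma modulated_eq: "modulated g e t = mod_low t + mod_high t"
  by (simp add: mod_high_def)

text \<open>A low \<open>k\<close> is below \<open>L / 4\<close> and \<open>n\<close> is at least
  \<open>3 L / 8\<close> in modulus, so the modulating factor is tested at distance at least
  \<open>L / 8\<close>, where its coefficients are at most \<open>64 B E / L\<^sup>2\<close>. The
  high part is controlled by its sup norm alone.\<close>

lemma norm_coef_modulated_le:
  assumes n: "3 * L \<le> 8 * \<bar>n\<bar>"
  shows "norm (P.coef (modulated g e) n) \<le> tail_bound C p + coef_total g C * (64 * B * E / (of_int L)\<^sup>2)"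
proof -
  have split: "P.coef (modulated g e) n = P.coef mod_low n + P.coef mod_high n"
    unfolding P.coef_add[OF mod_low_cont mod_high_cont, symmetric]
    by (rule P.coef_cong) (rule modulated_eq)
  have low: "P.coef mod_low n = (\<Sum>k\<in>low_freqs. S.coef g k * P.coef (\<lambda>t. expi (mod_phase k e t)) (n - k))"
    unfolding mod_low_def[abs_def]
    by (subst P.coef_sum[OF finite_low_freqs])
       (simp_all add: P.coef_cmult P.coef_shift continuous_on_mult_left shifted_mod_phase_cont)
  have bound: "norm (P.coef (modulated g e) n) \<le>
      (\<Sum>k\<in>low_freqs. norm (S.coef g k) * (64 * B * E / (of_int L)\<^sup>2)) + tail_bound C p"
    unfolding split low
  proof (rule norm_triangle_mono[OF sum_norm_le])
    fix k assume "k \<in> low_freqs"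
    then have k: "4 * \<bar>k\<bar> < L" by (simp add: low_freqs_def)
    have "L \<le> 8 * x" if "4 * y < L" "3 * L \<le> 8 * z" "z - y \<le> x" for x y z
      using that by linarith
    from this[OF k n abs_triangle_ineq2] have nk: "L \<le> 8 * \<bar>n - k\<bar>" .
    then have "n - k \<noteq> 0" "\<bar>k\<bar> \<le> L" using L(1) k by auto
    then have "norm (P.coef (\<lambda>t. expi (mod_phase k e t)) (n - k)) \<le> B * E / (real_of_int (n - k))\<^sup>2"
      using e by (intro norm_coef_mod_phase_le)
    also have "\<dots> \<le> B * E / (of_int L / 8)\<^sup>2"
    proof (intro divide_left_mono mult_nonneg_nonneg B_nonneg E_nonneg)
      have "real_of_int L \<le> of_int (8 * \<bar>n - k\<bar>)" using nk by (simp only: of_int_le_iff)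
      then have "of_int L / 8 \<le> \<bar>real_of_int (n - k)\<bar>" by simp
      then show "(of_int L / 8)\<^sup>2 \<le> (real_of_int (n - k))\<^sup>2"
        using L_pos(1) by (subst abs_le_square_iff[symmetric]) auto
      show "0 < (real_of_int (n - k))\<^sup>2 * (of_int L / 8)\<^sup>2"
        using L_pos(1) \<open>n - k \<noteq> 0\<close> by simp
    qed
    also have "\<dots> = 64 * B * E / (of_int L)\<^sup>2"
      by (simp add: power_divide)
    finally show "norm (S.coef g k * P.coef (\<lambda>t. expi (mod_phase k e t)) (n - k))
        \<le> norm (S.coef g k) * (64 * B * E / (of_int L)\<^sup>2)"
      unfolding norm_mult by (intro mult_left_mono) auto
  next
    show "norm (P.coef mod_high n) \<le> tail_bound C p"
      by (rule P.norm_coef_le[OF mod_high_cont mod_high_le])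
  qed
  have "(\<Sum>k\<in>low_freqs. norm (S.coef g k) * (64 * B * E / (of_int L)\<^sup>2)) \<le> coef_total g C * (64 * B * E / (of_int L)\<^sup>2)"
    unfolding sum_distrib_right[symmetric]
    by (rule mult_right_mono[OF sum_low_coefs_le]) (simp add: B_nonneg E_nonneg)
  with bound show ?thesis by linarith
qed

text \<open>Pulling out \<open>expi (k s)\<close> translates the window \<open>W\<close> by
  \<open>k\<close>; as \<open>k\<close> is low, the translate still contains everything below
  \<open>L / 8\<close>, and inversion applies to the modulating factor. In the high part each of the
  \<open>card W\<close> coefficients is bounded by the sup norm.\<close>

lemma modulated_partial_sum_error:
  assumes W: "finite W" "{j. 8 * \<bar>j\<bar> < 3 * L} \<subseteq> W" and t: "t \<in> {0..1}"
  shows "norm (modulated g e t - P.partial_sum (modulated g e) W t)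
      \<le> (1 + card W) * tail_bound C p + coef_total g C * (32 * B * E / of_int L)"
proof -
  let ?h = "\<lambda>k t. expi (of_int k * s t) * expi (mod_phase k e t)"
  have "P.partial_sum (modulated g e) W t = P.partial_sum (\<lambda>t. mod_low t + mod_high t) W t"
    by (simp only: modulated_eq[abs_def])
  also have "\<dots> = P.partial_sum mod_low W t + P.partial_sum mod_high W t"
    by (rule P.partial_sum_add[OF mod_low_cont mod_high_cont])
  also have "P.partial_sum mod_low W t = (\<Sum>k\<in>low_freqs. S.coef g k * P.partial_sum (?h k) W t)"
    unfolding mod_low_def[abs_def]
    by (rule P.partial_sum_cmult_sum[OF finite_low_freqs shifted_mod_phase_cont])
  finally have a: "P.partial_sum (modulated g e) W t
      = (\<Sum>k\<in>low_freqs. S.coef g k * P.partial_sum (?h k) W t) + P.partial_sum mod_high W t" .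
  have b: "modulated g e t = (\<Sum>k\<in>low_freqs. S.coef g k * ?h k t) + mod_high t"
    by (simp add: modulated_eq mod_low_def)
  have split: "modulated g e t - P.partial_sum (modulated g e) W t =
      (\<Sum>k\<in>low_freqs. S.coef g k * (?h k t - P.partial_sum (?h k) W t))
      + (mod_high t - P.partial_sum mod_high W t)"
    unfolding a b by (simp add: right_diff_distrib sum_subtractf)
  have bound: "norm (modulated g e t - P.partial_sum (modulated g e) W t)
      \<le> (\<Sum>k\<in>low_freqs. norm (S.coef g k) * (32 * B * E / of_int L))
      + (tail_bound C p + card W * tail_bound C p)"
    unfolding split
  proof (rule norm_triangle_mono[OF sum_norm_le])
    fix k assume "k \<in> low_freqs"
    then have k: "4 * \<bar>k\<bar> < L" by (simp add: low_freqs_def)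
    then have kL: "\<bar>k\<bar> \<le> L" by linarith
    let ?f = "\<lambda>t. expi (mod_phase k e t)" and ?W = "(\<lambda>j. j - k) ` W"
    have "?h k t - P.partial_sum (?h k) W t = expi (of_int k * s t) * (?f t - P.partial_sum ?f ?W t)"
      unfolding P.partial_sum_shift by (simp add: right_diff_distrib)
    moreover have "norm (?f t - P.partial_sum ?f ?W t) \<le> 4 * (B * E) / (of_int L / 8)"
    proof (rule P.partial_sum_error[OF _ _ _ _ _ _ t])
      show "continuous_on {0..1} ?f" by (intro continuous_intros mod_phase_cont)
      show "1 \<le> (of_int L / 8 :: real)" using L_pos(1) by simp
      show "0 \<le> B * E" using B_nonneg E_nonneg by simp
      show "norm (P.coef ?f j) \<le> B * E / (real_of_int j)\<^sup>2" if "of_int L / 8 \<le> \<bar>real_of_int j\<bar>" for j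
        using that L_pos(1) by (intro norm_coef_mod_phase_le kL e) auto
      show "finite ?W" using W by simp
      show "{j. \<bar>real_of_int j\<bar> < of_int L / 8} \<subseteq> ?W"
      proof
        fix j :: int assume "j \<in> {j. \<bar>real_of_int j\<bar> < of_int L / 8}"
        then have "real_of_int (8 * \<bar>j\<bar>) < of_int L" by simp
        then have "8 * \<bar>j\<bar> < L" unfolding of_int_less_iff .
        have "8 * x < 3 * L" if "8 * y < L" "4 * z < L" "x \<le> y + z" for x y z
          using that by linarith
        from this[OF \<open>8 * \<bar>j\<bar> < L\<close> k abs_triangle_ineq] have "8 * \<bar>j + k\<bar> < 3 * L" .
        then have "j + k \<in> W" using W(2) by auto
        then show "j \<in> ?W" by (auto intro: image_eqI[of _ _ "j + k"])
      qed
    qed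
    ultimately show "norm (S.coef g k * (?h k t - P.partial_sum (?h k) W t))
        \<le> norm (S.coef g k) * (32 * B * E / of_int L)"
      by (simp only: norm_mult norm_expi mult_1_left) (intro mult_left_mono, auto)
  next
    show "norm (mod_high t - P.partial_sum mod_high W t) \<le> tail_bound C p + card W * tail_bound C p"
      by (intro norm_triangle_le_diff add_mono mod_high_le t
          P.norm_partial_sum_le[OF mod_high_cont mod_high_le W(1)])
  qed
  have "(\<Sum>k\<in>low_freqs. norm (S.coef g k) * (32 * B * E / of_int L)) \<le> coef_total g C * (32 * B * E / of_int L)"
    unfolding sum_distrib_right[symmetric] using L_pos(1)
    by (intro mult_right_mono[OF sum_low_coefs_le]) (simp add: B_nonneg E_nonneg)
  with bound show ?thesis by (simp add: distrib_right)
qed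

end
end

subsection \<open>The demodulated signal\<close>

context phase_pair
begin

section \<open>The band-limited sums of the iteration in terms of Fourier coefficients\<close>

lemma norm_phase_\<theta>:
  assumes "t \<in> {0..1}"
  shows "norm_phase \<theta> t = \<sigma> t"
  using \<theta>_eq[OF assms] \<theta>_eq[of 1] \<sigma>_1 L_pos(1) by (simp add: norm_phase_def num_periods_def)

lemma phase_fourier_\<theta>: "phase_fourier \<theta> g (of_int n) = S.coef (\<lambda>t. of_real (g t)) n"
  unfolding phase_fourier_def S.coef_def
proof (rule integral_cong)
  fix t :: real assume t: "t \<in> {0..1}"
  have "deriv01 (norm_phase \<theta>) t = Re (trig_poly M w t)"
    using t norm_phase_\<theta> by (intro deriv01_eqI has_vector_derivative_transform[OF t _ S.s_deriv[OF t]]) auto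
  then show "of_real (g t) * expi (- (of_int n * norm_phase \<theta> t)) * of_real (deriv01 (norm_phase \<theta>) t) =
      of_real (g t) * expi (- (of_int n * \<sigma> t)) * of_real (Re (trig_poly M w t))"
    by (simp add: norm_phase_\<theta>[OF t])
qed

lemma phase_fourier_\<phi>: "phase_fourier \<phi> g (of_int n) = P.coef (\<lambda>t. of_real (g t)) n"
  unfolding phase_fourier_def P.coef_def norm_phase_\<phi>
proof (rule integral_cong)
  fix t :: real assume t: "t \<in> {0..1}"
  have "deriv01 s t = \<rho> t"
    using P.s_deriv[OF t] t by (rule deriv01_eqI)
  then show "of_real (g t) * expi (- (of_int n * s t)) * of_real (deriv01 s t) =
      of_real (g t) * expi (- (of_int n * s t)) * of_real (\<rho> t)"
    by simp
qed

definition band :: "int set" where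
  "band = {j. 2 * \<bar>j\<bar> < L'}"

lemma finite_band: "finite band"
  by (rule finite_subset[of _ "{- L'..L'}"]) (auto simp: band_def)

lemma L'_int_bounds: "3 * L \<le> 4 * L'" "4 * L' \<le> 5 * L"
proof -
  have "real_of_int (3 * L) \<le> of_int (4 * L')" "real_of_int (4 * L') \<le> of_int (5 * L)"
    using L'_bounds by simp_all
  then show "3 * L \<le> 4 * L'" "4 * L' \<le> 5 * L"
    by (simp_all only: of_int_le_iff)
qed

lemma card_band: "real (card band) \<le> 2 * of_int L"
proof -
  have "band \<subseteq> {- (L' div 2)..L' div 2}"
    unfolding band_def by auto
  then have "card band \<le> card {- (L' div 2)..L' div 2}"
    by (intro card_mono) auto
  also have "\<dots> = nat (2 * (L' div 2) + 1)" by simp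
  also have "\<dots> \<le> nat (2 * L)"
    using L'_int_bounds L(1) L_pos(3) by (intro nat_mono) linarith
  finally have "real (card band) \<le> real (nat (2 * L))" by simp
  then show ?thesis using L(1) by simp
qed

lemma band_reindex: "(\<Sum>j\<in>band. g (- j)) = (\<Sum>j\<in>band. g j)"
  by (rule sum.reindex_bij_witness[of _ uminus uminus]) (auto simp: band_def)

text \<open>This is \<open>z\<close> of the overview. The factor 2 restores the amplitude, because
  each of the two exponentials in the cosine carries half of it.\<close>

definition demod :: "(real \<Rightarrow> real) \<Rightarrow> real \<Rightarrow> complex" where
  "demod f t = 2 * (\<Sum>j\<in>band. P.coef (\<lambda>t. of_real (f t)) (j + L') * expi (of_int j * s t))"

lemma cutoff_sum:
  "(\<Sum>\<^sub>\<infinity>j\<in>UNIV. c j * complex_of_real (cutoff (of_int j / of_int L')) * expi (of_int j * x))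
     = (\<Sum>j\<in>band. c j * expi (of_int j * x))"
proof -
  have cut: "cutoff (of_int j / of_int L') = (if j \<in> band then 1 else 0)" for j
  proof -
    have "- 1 / 2 < real_of_int j / of_int L' \<and> real_of_int j / of_int L' < 1 / 2
        \<longleftrightarrow> real_of_int (- L') < of_int (2 * j) \<and> real_of_int (2 * j) < of_int L'"
      using L_pos(2) by (auto simp: field_simps)
    also have "\<dots> \<longleftrightarrow> j \<in> band"
      unfolding of_int_less_iff band_def by auto
    finally show ?thesis by (simp add: cutoff_def)
  qed
  have "(\<Sum>\<^sub>\<infinity>j\<in>UNIV. c j * complex_of_real (cutoff (of_int j / of_int L')) * expi (of_int j * x))
      = (\<Sum>\<^sub>\<infinity>j\<in>band. c j * expi (of_int j * x))"
    by (rule infsum_cong_neutral) (auto simp: cut)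
  then show ?thesis using finite_band by simp
qed

text \<open>For a real signal the sum with frequencies \<open>j - L'\<close> is the complex conjugate of the one with
  frequencies \<open>j + L'\<close>, so that \<open>coef_a + \<i> coef_b\<close> is a single band-limited sum.\<close>

lemma coef_ab_eq: "coef_a f \<phi> t = Re (demod f t)" "coef_b f \<phi> t = Im (demod f t)"
proof -
  let ?c = "\<lambda>n. P.coef (\<lambda>t. of_real (f t)) n"
  define Z where "Z = (\<Sum>j\<in>band. ?c (j + L') * expi (of_int j * s t))"
  have cnj: "?c (- n) = cnj (?c n)" for n
    using P.coef_cnj[of "\<lambda>t. of_real (f t)" "- n"] by simp
  have "(\<Sum>j\<in>band. ?c (j - L') * expi (of_int j * s t))
      = (\<Sum>j\<in>band. ?c (- j - L') * expi (of_int (- j) * s t))"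
    by (rule band_reindex[symmetric])
  also have "\<dots> = (\<Sum>j\<in>band. cnj (?c (j + L') * expi (of_int j * s t)))"
    using cnj[of "j + L'" for j] by (intro sum.cong) simp_all
  finally have cnj_Z: "cnj Z = (\<Sum>j\<in>band. ?c (j - L') * expi (of_int j * s t))"
    by (simp add: Z_def)
  have demod: "demod f t = 2 * Z"
    by (simp add: demod_def Z_def)
  have pf: "phase_fourier \<phi> f (of_int j + of_int L') = ?c (j + L')"
    "phase_fourier \<phi> f (of_int j - of_int L') = ?c (j - L')" for j
    using phase_fourier_\<phi>[of f "j + L'"] phase_fourier_\<phi>[of f "j - L'"] by simp_all
  have "coef_a f \<phi> t = Re (Z + cnj Z)"
    unfolding coef_a_def num_periods_\<phi> norm_phase_\<phi> cutoff_sum pf cnj_Z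
    unfolding Z_def
    by (simp only: distrib_right sum.distrib)
  then show "coef_a f \<phi> t = Re (demod f t)"
    by (simp add: demod)
  have "coef_b f \<phi> t = Re (- \<i> * (Z - cnj Z))"
    unfolding coef_b_def num_periods_\<phi> norm_phase_\<phi> cutoff_sum pf cnj_Z
    unfolding Z_def
    by (simp only: left_diff_distrib sum_subtractf sum_distrib_left mult.assoc right_diff_distrib)
  then show "coef_b f \<phi> t = Im (demod f t)"
    by (simp add: demod)
qed

end

section \<open>The three frequency groups of the signal\<close>

locale signal_phase = phase_pair +
  fixes f0 f1 :: "real \<Rightarrow> real" and C p F :: real
  assumes f0_cont: "continuous_on {0..1} f0" and f1_cont: "continuous_on {0..1} f1"
    and C: "0 < C" and p: "4 \<le> p"
    and decay0: "fast_decay C p \<theta> f0" and decay1: "fast_decay C p \<theta> f1"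
    and F: "\<And>t. t \<in> {0..1} \<Longrightarrow> \<bar>f1 t\<bar> \<le> F"
begin

text \<open>\<open>s\<close> starts at 0, so the initial value of the phase survives as the constant
  rotation by the angle \<open>\<phi> 0\<close>.\<close>

definition rot :: complex where
  "rot = expi (\<phi> 0 / (2 * pi))"

text \<open>The decay assumption leaves the mean of \<open>f0\<close> uncontrolled, so no bound may
  involve it. A constant has only the coefficient of index 0, which the frequencies
  \<open>j + L'\<close> with \<open>j\<close> in the band avoid.\<close>

definition centred0 :: "real \<Rightarrow> complex" where
  "centred0 t = of_real (f0 t) - S.coef (\<lambda>t. of_real (f0 t)) 0"

abbreviation f1c :: "real \<Rightarrow> complex" where
  "f1c \<equiv> \<lambda>t. of_real (f1 t)"

abbreviation f :: "real \<Rightarrow> real" where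
  "f \<equiv> signal f0 f1 \<theta>"

lemma centred0_cont: "continuous_on {0..1} centred0"
  unfolding centred0_def[abs_def] by (intro continuous_intros f0_cont)

lemma f1c_cont: "continuous_on {0..1} f1c"
  by (intro continuous_intros f1_cont)

lemma coef_centred0: "S.coef centred0 k = (if k = 0 then 0 else S.coef (\<lambda>t. of_real (f0 t)) k)"
  unfolding centred0_def[abs_def]
  by (subst S.coef_diff) (simp_all add: S.coef_const continuous_on_of_real f0_cont)

lemma centred0_decay: "k \<noteq> 0 \<Longrightarrow> norm (S.coef centred0 k) \<le> C * \<bar>real_of_int k\<bar> powr (- p)"
  using decay0 by (simp add: fast_decay_def coef_centred0 phase_fourier_\<theta>)

lemma f1c_decay: "k \<noteq> 0 \<Longrightarrow> norm (S.coef f1c k) \<le> C * \<bar>real_of_int k\<bar> powr (- p)"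
  using decay1 by (simp add: fast_decay_def phase_fourier_\<theta>)

lemma totals: "coef_total centred0 C \<le> F + 4 * C" "coef_total f1c C \<le> F + 4 * C"
proof -
  have "0 \<le> F" using F[of 0] by simp
  moreover have "norm (S.coef f1c 0) \<le> F"
    using F by (intro S.norm_coef_le f1c_cont) simp
  ultimately show "coef_total centred0 C \<le> F + 4 * C" "coef_total f1c C \<le> F + 4 * C"
    by (simp_all add: coef_total_def coef_centred0)
qed

lemma signal_decomposition:
  assumes "t \<in> {0..1}"
  shows "2 * complex_of_real (f t) = 2 * centred0 t + 2 * S.coef (\<lambda>t. of_real (f0 t)) 0
     + rot * (expi (of_int L' * s t) * modulated f1c 1 t)
     + cnj rot * (expi (of_int (- L') * s t) * modulated f1c (- 1) t)"
proof -
  have \<theta>: "\<theta> t / (2 * pi) = \<phi> 0 / (2 * pi) + (of_int L' * s t + \<psi> t / (2 * pi))"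
    using L_pos(2) by (simp add: s_def \<psi>_def field_simps)
  have e1: "expi (\<theta> t / (2 * pi)) = rot * (expi (of_int L' * s t) * expi (\<psi> t / (2 * pi)))"
    unfolding \<theta> expi_add rot_def ..
  have e2: "expi (- (\<theta> t / (2 * pi))) = cnj rot * (expi (of_int (- L') * s t) * expi (- (\<psi> t / (2 * pi))))"
    using arg_cong[OF e1, of cnj] by simp
  have "2 * complex_of_real (cos (\<theta> t)) = expi (\<theta> t / (2 * pi)) + expi (- (\<theta> t / (2 * pi)))"
    by (simp add: expi_def cos_of_real[symmetric] cos_exp_eq)
  moreover have "2 * complex_of_real (f t) = 2 * of_real (f0 t)
      + of_real (f1 t) * (2 * of_real (cos (\<theta> t)))"
    by (simp add: signal_def algebra_simps)
  ultimately have "2 * complex_of_real (f t) = 2 * of_real (f0 t)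
      + of_real (f1 t) * (expi (\<theta> t / (2 * pi)) + expi (- (\<theta> t / (2 * pi))))"
    by simp
  then show ?thesis
    unfolding e1 e2 by (simp add: centred0_def modulated_def algebra_simps)
qed

text \<open>The shifted signal shows at \<open>j\<close> the envelope at \<open>j\<close>, the local
  mean at \<open>j + L'\<close> and the mirror image of the envelope at \<open>j + 2 L'\<close>.
  Only the first is wanted; the other two indices are far from all low frequencies.\<close>

lemma coef_signal:
  assumes "j \<in> band"
  shows "2 * P.coef (\<lambda>t. of_real (f t)) (j + L') = rot * P.coef (modulated f1c 1) j
     + (2 * P.coef (modulated centred0 0) (j + L') + cnj rot * P.coef (modulated f1c (- 1)) (j + 2 * L'))"
proof -
  have j: "j + L' \<noteq> 0" using assms L_pos(3) by (auto simp: band_def)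
  note cont = centred0_cont modulated_cont[OF f1c_cont] P.s_cont
  have "2 * P.coef (\<lambda>t. of_real (f t)) (j + L') = P.coef (\<lambda>t. 2 * of_real (f t)) (j + L')"
    by (rule P.coef_cmult[symmetric])
  also have "\<dots> = P.coef (\<lambda>t. 2 * centred0 t + 2 * S.coef (\<lambda>t. of_real (f0 t)) 0
     + rot * (expi (of_int L' * s t) * modulated f1c 1 t)
     + cnj rot * (expi (of_int (- L') * s t) * modulated f1c (- 1) t)) (j + L')"
    by (rule P.coef_cong) (rule signal_decomposition)
  also have "\<dots> = 2 * P.coef centred0 (j + L') + rot * P.coef (modulated f1c 1) j
     + cnj rot * P.coef (modulated f1c (- 1)) (j + L' + L')"
    using j by (simp add: P.coef_add P.coef_cmult P.coef_const P.coef_shift[where k = "- L'", simplified]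
        P.coef_shift cont continuous_intros)
  also have "j + L' + L' = j + 2 * L'"
    by simp
  also have "centred0 = modulated centred0 0"
    by (simp add: modulated_def[abs_def])
  finally show ?thesis
    by (simp only: add_ac)
qed

text \<open>The wanted term is reproduced up to a truncation error. The unwanted coefficients are
  summed over at most \<open>2 L\<close> indices, so their part of order
  \<open>E / L\<^sup>2\<close> becomes \<open>E / L\<close>, and the high parts lose one power of
  \<open>L\<close>.\<close>

lemma demod_error:
  assumes t: "t \<in> {0..1}"
  shows "norm (demod f t - rot * modulated f1c 1 t)
     \<le> 144 * C * (of_int L / 4) powr (- p + 2) + 416 * (F + 4 * C) * B * E / of_int L"
proof -
  let ?T = "tail_bound C p" and ?N = "real (card band)"
  let ?e = "(F + 4 * C) * (64 * B * E / (of_int L)\<^sup>2)"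
  have Lb: "(of_int L :: real) > 0" using L_pos(1) by simp
  have BE: "0 \<le> B * E" using B_nonneg E_nonneg by simp
  have FC: "0 \<le> F + 4 * C" using F[of 0] C by simp
  have band_le: "3 * L \<le> 8 * \<bar>j + L'\<bar>" "3 * L \<le> 8 * \<bar>j + 2 * L'\<bar>" if "j \<in> band" for j
    using that L'_int_bounds by (auto simp: band_def)
  have low: "norm (P.coef (modulated centred0 0) (j + L')) \<le> ?T + ?e"
    "norm (P.coef (modulated f1c (- 1)) (j + 2 * L')) \<le> ?T + ?e" if j: "j \<in> band" for j
  proof -
    have "x * (64 * B * E / (of_int L)\<^sup>2) \<le> ?e" if "x \<le> F + 4 * C" for x
      using that BE by (intro mult_right_mono) (auto simp: mult.assoc)
    note le = this[OF totals(1)] this[OF totals(2)]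
    show "norm (P.coef (modulated centred0 0) (j + L')) \<le> ?T + ?e"
      using norm_coef_modulated_le[OF centred0_cont less_imp_le[OF C] p _ centred0_decay band_le(1)[OF j], of 0] le(1)
      by simp
    show "norm (P.coef (modulated f1c (- 1)) (j + 2 * L')) \<le> ?T + ?e"
      using norm_coef_modulated_le[OF f1c_cont less_imp_le[OF C] p _ f1c_decay band_le(2)[OF j], of "- 1"] le(2)
      by simp
  qed
  have main: "norm (modulated f1c 1 t - P.partial_sum (modulated f1c 1) band t)
      \<le> (1 + ?N) * ?T + (F + 4 * C) * (32 * B * E / of_int L)"
  proof -
    have "{j. 8 * \<bar>j\<bar> < 3 * L} \<subseteq> band"
      using L'_int_bounds by (auto simp: band_def)
    from modulated_partial_sum_error[OF f1c_cont less_imp_le[OF C] p _ f1c_decay finite_band this t, of 1]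
    have "norm (modulated f1c 1 t - P.partial_sum (modulated f1c 1) band t)
      \<le> (1 + ?N) * ?T + coef_total f1c C * (32 * B * E / of_int L)" by simp
    also have "coef_total f1c C * (32 * B * E / of_int L) \<le> (F + 4 * C) * (32 * B * E / of_int L)"
      by (rule mult_right_mono[OF totals(2)]) (use BE Lb in \<open>simp add: mult.assoc\<close>)
    finally show ?thesis by simp
  qed
  let ?R = "\<lambda>j. 2 * P.coef (modulated centred0 0) (j + L') + cnj rot * P.coef (modulated f1c (- 1)) (j + 2 * L')"
  have "demod f t = (\<Sum>j\<in>band. (rot * P.coef (modulated f1c 1) j + ?R j) * expi (of_int j * s t))"
    unfolding demod_def sum_distrib_left mult.assoc[symmetric]
    by (intro sum.cong refl) (simp only: coef_signal)
  also have "\<dots> = rot * P.partial_sum (modulated f1c 1) band t + (\<Sum>j\<in>band. ?R j * expi (of_int j * s t))"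
    by (simp only: P.partial_sum_def distrib_right sum.distrib sum_distrib_left mult.assoc)
  finally have "demod f t - rot * modulated f1c 1 t =
      rot * (P.partial_sum (modulated f1c 1) band t - modulated f1c 1 t)
      + (\<Sum>j\<in>band. ?R j * expi (of_int j * s t))"
    by (simp only: right_diff_distrib) simp
  then have "norm (demod f t - rot * modulated f1c 1 t) \<le>
      ((1 + ?N) * ?T + (F + 4 * C) * (32 * B * E / of_int L)) + ?N * (3 * (?T + ?e))"
  proof (simp only:, intro norm_triangle_mono)
    show "norm (rot * (P.partial_sum (modulated f1c 1) band t - modulated f1c 1 t))
        \<le> (1 + ?N) * ?T + (F + 4 * C) * (32 * B * E / of_int L)"
      using main by (simp add: norm_mult rot_def norm_minus_commute)
    have "norm (?R j * expi (of_int j * s t)) \<le> 3 * (?T + ?e)" if "j \<in> band" for j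
    proof -
      have "norm (?R j) \<le> 2 * (?T + ?e) + (?T + ?e)"
        using low[OF that] by (intro norm_triangle_mono) (simp_all add: norm_mult rot_def)
      also have "\<dots> = 3 * (?T + ?e)"
      proof -
        have "2 * x + x = 3 * x" for x :: real by simp
        then show ?thesis .
      qed
      finally show ?thesis
        by (simp only: norm_mult[of _ "expi _"] norm_expi mult_1_right)
    qed
    then have "norm (\<Sum>j\<in>band. ?R j * expi (of_int j * s t)) \<le> (\<Sum>j\<in>band. 3 * (?T + ?e))"
      by (rule sum_norm_le)
    then show "norm (\<Sum>j\<in>band. ?R j * expi (of_int j * s t)) \<le> ?N * (3 * (?T + ?e))"
      by (simp only: sum_constant)
  qed
  also have "\<dots> = (1 + 4 * ?N) * ?T + (F + 4 * C) * (32 * B * E / of_int L) + 3 * ?N * ?e"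
    by (simp add: algebra_simps)
  also have "\<dots> \<le> 9 * of_int L * ?T + (F + 4 * C) * (32 * B * E / of_int L) + 3 * (2 * of_int L) * ?e"
  proof (rule add_mono[OF add_mono[OF mult_right_mono order_refl] mult_right_mono])
    show "1 + 4 * ?N \<le> 9 * of_int L" using card_band L_pos(1) by linarith
    show "0 \<le> ?T" unfolding tail_bound_def using C Lb by simp
    show "3 * ?N \<le> 3 * (2 * of_int L)" using card_band by simp
    show "0 \<le> ?e" using FC BE by (simp add: mult.assoc)
  qed
  \<comment> \<open>\<open>144 = 9 * 16\<close> with the 16 of \<open>tail_bound\<close>, and
    \<open>416 = 32 + 6 * 64\<close>.\<close>
  also have "\<dots> = 144 * C * (of_int L / 4) powr (- p + 2) + 416 * (F + 4 * C) * B * E / of_int L"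
  proof -
    have "9 * of_int L * ?T = 144 * C * (of_int L / 4) powr (- p + 2)"
      using Lb by (simp add: tail_bound_def)
    moreover have "(F + 4 * C) * (32 * B * E / of_int L) + 3 * (2 * of_int L) * ?e
        = 416 * (F + 4 * C) * B * E / of_int L"
      using Lb by (simp add: power2_eq_square field_simps)
    ultimately show ?thesis by simp
  qed
  finally show ?thesis .
qed

end

subsection \<open>The angle and its Fourier coefficients\<close>

text \<open>The derivative of any branch of the argument is the imaginary part of the logarithmic
  derivative, and the principal arctangent differs from such a branch by a constant on either side
  of the imaginary axis.\<close>

lemma arctan_quotient_has_vector_derivative:
  fixes u :: "real \<Rightarrow> complex"
  assumes u: "(u has_vector_derivative u') (at t within A)" and nz: "Re (u t) \<noteq> 0"
  shows "((\<lambda>t. arctan (Im (u t) / Re (u t))) has_vector_derivative Im (u' / u t)) (at t within A)"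
proof -
  have re: "((\<lambda>t. Re (u t)) has_real_derivative Re u') (at t within A)"
    and im: "((\<lambda>t. Im (u t)) has_real_derivative Im u') (at t within A)"
    using bounded_linear.has_vector_derivative[OF bounded_linear_Re u]
      bounded_linear.has_vector_derivative[OF bounded_linear_Im u]
    by (simp_all add: has_real_derivative_iff_has_vector_derivative)
  have "((\<lambda>t. arctan (Im (u t) / Re (u t))) has_real_derivative
     inverse (1 + (Im (u t) / Re (u t))\<^sup>2) * ((Im u' * Re (u t) - Im (u t) * Re u') / (Re (u t) * Re (u t))))
     (at t within A)"
    by (rule DERIV_chain2[OF DERIV_arctan DERIV_divide[OF im re nz]])
  also have "inverse (1 + (Im (u t) / Re (u t))\<^sup>2) * ((Im u' * Re (u t) - Im (u t) * Re u') / (Re (u t) * Re (u t)))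
      = Im (u' / u t)"
  proof -
    let ?x = "Re (u t)" and ?y = "Im (u t)"
    have pos: "0 < ?x\<^sup>2 + ?y\<^sup>2" using nz by (simp add: sum_power2_gt_zero_iff)
    have "1 + (?y / ?x)\<^sup>2 = (?x\<^sup>2 + ?y\<^sup>2) / ?x\<^sup>2"
      using nz by (simp add: power_divide add_divide_distrib)
    then have "inverse (1 + (?y / ?x)\<^sup>2) * ((Im u' * ?x - ?y * Re u') / (?x * ?x))
        = (Im u' * ?x - ?y * Re u') / (?x\<^sup>2 + ?y\<^sup>2)"
      using nz pos by (simp add: power2_eq_square)
    also have "\<dots> = Im (u' / u t)"
      by (simp add: Im_divide mult.commute)
    finally show ?thesis .
  qed
  finally show ?thesis
    by (simp add: has_real_derivative_iff_has_vector_derivative)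
qed

context unit_phase
begin

text \<open>Multiplied by \<open>expi (N s)\<close>, the sum becomes a polynomial in
  \<open>expi (s t)\<close>. Either this is the zero polynomial or it has finitely many roots, each
  attained at most once on the half-open interval; the point 1 is added at the end.\<close>

lemma trig_sum_zeros_finite:
  assumes K: "finite K"
  shows "(\<forall>t. (\<Sum>j\<in>K. c j * expi (of_int j * s t)) = 0)
    \<or> finite {t \<in> {0..1}. (\<Sum>j\<in>K. c j * expi (of_int j * s t)) = 0}"
proof -
  obtain N :: nat where N: "\<And>j. j \<in> K \<Longrightarrow> \<bar>j\<bar> \<le> int N"
  proof
    show "\<bar>j\<bar> \<le> int (nat (Max (insert 0 (abs ` K))))" if "j \<in> K" for j
      using K that Max_ge[of "insert 0 (abs ` K)" "\<bar>j\<bar>"] by (auto simp: le_nat_iff)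
  qed
  define P where "P = (\<Sum>j\<in>K. monom (c j) (nat (j + int N)))"
  have pow: "expi x ^ n = expi (of_nat n * x)" for x n
    by (induction n) (simp_all add: expi_add[symmetric] algebra_simps)
  have P: "poly P (expi (s t)) = expi (of_nat N * s t) * (\<Sum>j\<in>K. c j * expi (of_int j * s t))" for t
  proof -
    have "poly P (expi (s t)) = (\<Sum>j\<in>K. c j * expi (of_nat (nat (j + int N)) * s t))"
      by (simp add: P_def poly_sum poly_monom pow)
    also have "\<dots> = (\<Sum>j\<in>K. expi (of_nat N * s t) * (c j * expi (of_int j * s t)))"
    proof (rule sum.cong)
      fix j assume "j \<in> K"
      then have "j + int N \<ge> 0" using N[of j] by simp
      then have "real (nat (j + int N)) = of_nat N + of_int j" by simp
      then show "c j * expi (of_nat (nat (j + int N)) * s t)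
          = expi (of_nat N * s t) * (c j * expi (of_int j * s t))"
        by (simp add: distrib_right expi_add)
    qed simp
    finally show ?thesis by (simp add: sum_distrib_left)
  qed
  show ?thesis
  proof (cases "P = 0")
    case True
    then have "(\<Sum>j\<in>K. c j * expi (of_int j * s t)) = 0" for t
      using P[of t] by simp
    then show ?thesis by blast
  next
    case False
    let ?Z = "{t \<in> {0..<1}. (\<Sum>j\<in>K. c j * expi (of_int j * s t)) = 0}"
    have "(\<lambda>t. expi (s t)) ` ?Z \<subseteq> {x. poly P x = 0}"
      using P by auto
    then have "finite ((\<lambda>t. expi (s t)) ` ?Z)"
      using poly_roots_finite[OF False] finite_subset by blast
    moreover have "inj_on (\<lambda>t. expi (s t)) ?Z"
    proof (rule inj_onI)
      fix x y assume "x \<in> ?Z" "y \<in> ?Z" "expi (s x) = expi (s y)"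
      then show "x = y" using s_inj[of x y] by (auto simp: doubleton_eq_iff)
    qed
    ultimately have "finite ?Z" by (rule finite_imageD)
    then have "finite (insert 1 ?Z)" by simp
    then show ?thesis by (rule disjI2[OF finite_subset[rotated]]) auto
  qed
qed

end

lemma fourier_uminus: "fourier g (- k) = cnj (fourier g k)"
  unfolding fourier_def integral_cnj by simp

lemma trig_poly_fourier_real: "Im (trig_poly M (fourier g) t) = 0"
proof -
  have "cnj (trig_poly M (fourier g) t) = (\<Sum>k\<in>{- int M..int M}. fourier g (- k) * expi (of_int (- k) * t))"
    by (simp add: trig_poly_def fourier_uminus)
  also have "\<dots> = trig_poly M (fourier g) t"
    unfolding trig_poly_def
    by (rule sum.reindex_bij_witness[of _ uminus uminus]) auto
  finally show ?thesis by (simp add: complex_eq_iff)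
qed

lemma proj_trig_eq: "proj_trig M g t = Re (trig_poly M (fourier g) t)"
  by (simp add: proj_trig_def trig_poly_def)

lemma fourier_derivative_bounded:
  assumes v: "\<And>t. t \<in> {0..1} \<Longrightarrow> (v has_vector_derivative v' t) (at t within {0..1})"
    and cont: "continuous_on {0..1} v'" and per: "v 0 = v 1"
    and B: "\<And>t. t \<in> {0..1} \<Longrightarrow> \<bar>v t\<bar> \<le> B"
  shows "fourier v' 0 = 0" "coef_sum_norm M (fourier v') \<le> (2 * real M + 1) * (2 * pi * M * B)"
proof -
  have eq: "fourier v' k = 2 * pi * \<i> * of_int k * fourier v k" for k
  proof -
    have "2 * pi * \<i> * of_int k * id_phase.coef (\<lambda>t. of_real (v t)) k
        = id_phase.coef (\<lambda>t. of_real (v' t) / of_real 1) k"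
      using v per has_vector_derivative_of_real[where 'a = complex]
      by (intro id_phase.coef_by_parts continuous_intros cont)
         (auto simp: has_real_derivative_iff_has_vector_derivative)
    then show ?thesis by (simp add: fourier_eq_coef)
  qed
  then show "fourier v' 0 = 0" by simp
  have v_cont: "continuous_on {0..1} v"
    using v by (rule continuous_on_vector_derivative)
  have bound: "norm (fourier v k) \<le> B" for k
    unfolding fourier_eq_coef
    by (rule id_phase.norm_coef_le) (use B v_cont in \<open>auto intro: continuous_on_of_real\<close>)
  have "norm (fourier v' k) \<le> 2 * pi * M * B" if "k \<in> {- int M..int M}" for k
  proof -
    have "\<bar>real_of_int k\<bar> \<le> real M" using that by auto
    then show ?thesis
      using bound[of k] unfolding eq by (simp add: norm_mult mult_mono)
  qed
  then have "coef_sum_norm M (fourier v') \<le> (\<Sum>k\<in>{- int M..int M}. 2 * pi * M * B)"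
    unfolding coef_sum_norm_def by (rule sum_mono)
  also have "\<dots> = (2 * real M + 1) * (2 * pi * M * B)" by simp
  finally show "coef_sum_norm M (fourier v') \<le> (2 * real M + 1) * (2 * pi * M * B)" .
qed

text \<open>\<open>\<epsilon> \<le> \<mu> / 2\<close> keeps the demodulated signal in the right
  half-plane, where the principal arctangent is the true angle; \<open>L_large\<close> keeps the
  phase nondecreasing after a full step.\<close>

locale small_error = signal_phase +
  fixes \<mu> \<epsilon> :: real
  assumes \<mu>: "0 < \<mu>" "\<And>t. t \<in> {0..1} \<Longrightarrow> \<mu> \<le> f1 t"
    and \<epsilon>: "144 * C * (of_int L / 4) powr (- p + 2) + 416 * (F + 4 * C) * B * E / of_int L \<le> \<epsilon>"
      "\<epsilon> \<le> \<mu> / 2"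
    and L_large: "(2 * real M + 1) * (2 * pi * M * (2 * \<epsilon> / \<mu>)) \<le> 2 * pi * of_int L * c0"
begin

abbreviation z :: "real \<Rightarrow> complex" where "z \<equiv> demod f"

definition z' :: "real \<Rightarrow> complex" where
  "z' t = 2 * (\<Sum>j\<in>band. P.coef (\<lambda>t. of_real (f t)) (j + L') *
     (2 * pi * \<i> * of_real (of_int j * \<rho> t) * expi (of_int j * s t)))"

definition \<psi>' :: "real \<Rightarrow> real" where "\<psi>' t = Re (trig_poly M q t)"

text \<open>\<open>z\<close> with the constant rotation and the exact angle \<open>\<psi>\<close>
  taken off, hence close to the positive function \<open>f1\<close>. Its angle
  \<open>residual\<close> is \<open>v\<close> of the overview.\<close>

definition u :: "real \<Rightarrow> complex" where
  "u t = cnj rot * z t * expi (- 1 / (2 * pi) * \<psi> t)"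

definition residual :: "real \<Rightarrow> real" where
  "residual t = arctan (Im (u t) / Re (u t))"

definition residual' :: "real \<Rightarrow> real" where
  "residual' t = Im (z' t / z t) - \<psi>' t"

lemma z_deriv:
  assumes "t \<in> {0..1}"
  shows "(z has_vector_derivative z' t) (at t within {0..1})"
proof -
  have "((\<lambda>t. of_int j * s t) has_vector_derivative of_int j * \<rho> t) (at t within {0..1})" for j
    by (intro has_vector_derivative_mult_right P.s_deriv assms)
  from expi_has_vector_derivative[OF this] show ?thesis
    unfolding demod_def[abs_def] z'_def
    by (intro has_vector_derivative_mult_right has_vector_derivative_sum)
qed

lemma z'_cont: "continuous_on {0..1} z'"
  unfolding z'_def[abs_def] by (intro continuous_intros P.s_cont P.\<rho>_cont)

lemma z_cont: "continuous_on {0..1} z"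
  using z_deriv by (rule continuous_on_vector_derivative)

lemma u_error:
  assumes t: "t \<in> {0..1}"
  shows "norm (u t - of_real (f1 t)) \<le> \<epsilon>"
proof -
  have rot: "cnj rot * rot = 1"
    by (simp add: rot_def expi_add[symmetric])
  have e: "expi (of_int 1 * (\<psi> t / (2 * pi))) * expi (- 1 / (2 * pi) * \<psi> t) = 1"
    by (simp add: expi_add[symmetric])
  have "cnj rot * (rot * modulated f1c 1 t) * expi (- 1 / (2 * pi) * \<psi> t)
      = of_real (f1 t) * (cnj rot * rot)
        * (expi (of_int 1 * (\<psi> t / (2 * pi))) * expi (- 1 / (2 * pi) * \<psi> t))"
    unfolding modulated_def by (simp only: mult_ac)
  also have "\<dots> = of_real (f1 t)"
    by (simp only: rot e mult_1_right)
  finally have "cnj rot * (rot * modulated f1c 1 t) * expi (- 1 / (2 * pi) * \<psi> t) = of_real (f1 t)" .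
  then have "u t - of_real (f1 t) = cnj rot * (z t - rot * modulated f1c 1 t) * expi (- 1 / (2 * pi) * \<psi> t)"
    unfolding u_def right_diff_distrib left_diff_distrib by simp
  then have "norm (u t - of_real (f1 t)) = norm (z t - rot * modulated f1c 1 t)"
    by (simp add: norm_mult rot_def)
  with demod_error[OF t] \<epsilon>(1) show ?thesis by simp
qed

lemma u_bounds:
  assumes t: "t \<in> {0..1}"
  shows "\<mu> / 2 \<le> Re (u t)" "\<bar>Im (u t)\<bar> \<le> \<epsilon>"
proof -
  have "\<bar>Re (u t) - f1 t\<bar> \<le> \<epsilon>"
    using abs_Re_le_cmod[of "u t - of_real (f1 t)"] u_error[OF t] by simp
  then have "f1 t - \<epsilon> \<le> Re (u t)" unfolding abs_le_iff by simp
  with \<mu>(2)[OF t] \<epsilon>(2) show "\<mu> / 2 \<le> Re (u t)" by linarith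
  show "\<bar>Im (u t)\<bar> \<le> \<epsilon>"
    using abs_Im_le_cmod[of "u t - of_real (f1 t)"] u_error[OF t] by simp
qed

lemma u_nonzero:
  assumes "t \<in> {0..1}"
  shows "Re (u t) \<noteq> 0" "u t \<noteq> 0" "z t \<noteq> 0"
proof -
  show 1: "Re (u t) \<noteq> 0" using u_bounds[OF assms] \<mu>(1) by auto
  then show "u t \<noteq> 0" by auto
  then show "z t \<noteq> 0" by (auto simp: u_def)
qed

lemma residual_deriv:
  assumes t: "t \<in> {0..1}"
  shows "(residual has_vector_derivative residual' t) (at t within {0..1})"
proof -
  let ?e = "expi (- 1 / (2 * pi) * \<psi> t)"
  have \<psi>: "(\<psi> has_vector_derivative \<psi>' t) (at t within {0..1})"
    unfolding \<psi>'_def by (rule trig_derivD(1)[OF \<psi>_deriv t])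
  have e: "((\<lambda>t. expi (- 1 / (2 * pi) * \<psi> t)) has_vector_derivative
      2 * pi * \<i> * of_real (- 1 / (2 * pi) * \<psi>' t) * ?e) (at t within {0..1})"
    by (intro expi_has_vector_derivative has_vector_derivative_mult_right \<psi>)
  let ?u' = "cnj rot * z t * (2 * pi * \<i> * of_real (- 1 / (2 * pi) * \<psi>' t) * ?e) + cnj rot * z' t * ?e"
  have "(u has_vector_derivative ?u') (at t within {0..1})"
    unfolding u_def[abs_def]
    by (intro has_vector_derivative_mult has_vector_derivative_mult_right z_deriv t e)
  from arctan_quotient_has_vector_derivative[OF this u_nonzero(1)[OF t]]
  have "(residual has_vector_derivative Im (?u' / u t)) (at t within {0..1})"
    by (simp only: residual_def[abs_def])
  moreover have "?u' = u t * (z' t / z t - \<i> * of_real (\<psi>' t))"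
    using u_nonzero(3)[OF t] by (simp add: u_def algebra_simps)
  then have "?u' / u t = z' t / z t - \<i> * of_real (\<psi>' t)"
    using u_nonzero(2)[OF t] by simp
  ultimately show ?thesis
    by (simp add: residual'_def)
qed

lemma residual'_cont: "continuous_on {0..1} residual'"
  unfolding residual'_def[abs_def] \<psi>'_def using u_nonzero(3)
  by (intro continuous_intros z_cont z'_cont trig_poly_cont) auto

lemma residual_periodic: "residual 0 = residual 1"
proof -
  have "demod f 0 = demod f 1"
    by (simp add: demod_def P.s_0 P.s_1)
  moreover have "expi (- 1 / (2 * pi) * \<psi> 0) = expi (- 1 / (2 * pi) * \<psi> 1)"
    using \<psi>_periodic[of "- 1"] by simp
  ultimately show ?thesis unfolding residual_def u_def by simp
qed

lemma residual_le:
  assumes t: "t \<in> {0..1}"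
  shows "\<bar>residual t\<bar> \<le> 2 * \<epsilon> / \<mu>"
proof -
  have "\<bar>residual t\<bar> \<le> \<bar>Im (u t) / Re (u t)\<bar>"
    unfolding residual_def by (rule abs_arctan_le)
  also have "\<dots> \<le> \<epsilon> / (\<mu> / 2)"
    unfolding abs_divide using u_bounds[OF t] \<mu>(1) by (intro frac_le) auto
  finally show ?thesis by (simp add: mult.commute)
qed

text \<open>Away from zeros of \<open>coef_a\<close> this is the logarithmic derivative. The zeros
  are finite in number unless \<open>coef_a\<close> vanishes identically; then \<open>z\<close> is
  purely imaginary, so \<open>Im (z' / z) = 0\<close>, in agreement with the derivative 0 that
  \<open>x / 0 = 0\<close> produces.\<close>

lemma angle_deriv:
  obtains N where "finite N"
    "\<And>t. t \<in> {0..1} - N \<Longrightarrow>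
       deriv01 (\<lambda>t. arctan (coef_b f \<phi> t / coef_a f \<phi> t)) t = \<psi>' t + residual' t"
proof -
  let ?c = "\<lambda>j. P.coef (\<lambda>t. of_real (f t)) (j + L')"
  \<comment> \<open>\<open>Re z = (z + cnj z) / 2\<close> is again a sum over the band, because the
    band is symmetric; these are its coefficients.\<close>
  define c where "c j = ?c j + cnj (?c (- j))" for j
  have re: "2 * complex_of_real (Re (z t)) = 2 * (\<Sum>j\<in>band. c j * expi (of_int j * s t))" for t
  proof -
    have "cnj (z t) = 2 * (\<Sum>j\<in>band. cnj (?c j) * expi (of_int (- j) * s t))"
      by (simp add: demod_def)
    also have "\<dots> = 2 * (\<Sum>j\<in>band. cnj (?c (- j)) * expi (of_int j * s t))"
      using band_reindex[of "\<lambda>j. cnj (?c (- j)) * expi (of_int j * s t)"] by simp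
    finally have cz: "cnj (z t) = 2 * (\<Sum>j\<in>band. cnj (?c (- j)) * expi (of_int j * s t))" .
    have "2 * complex_of_real (Re (z t)) = z t + cnj (z t)"
      by (simp add: complex_eq_iff)
    also have "\<dots> = 2 * (\<Sum>j\<in>band. c j * expi (of_int j * s t))"
      unfolding cz by (simp add: demod_def c_def distrib_right sum.distrib)
    finally show ?thesis .
  qed
  have zero_iff: "(\<Sum>j\<in>band. c j * expi (of_int j * s t)) = 0 \<longleftrightarrow> Re (z t) = 0" for t
  proof -
    have "(\<Sum>j\<in>band. c j * expi (of_int j * s t)) = complex_of_real (Re (z t))"
      using re[of t] by (subst (asm) mult_cancel_left) simp
    then show ?thesis by (simp only: of_real_eq_0_iff)
  qed
  consider "\<And>t. Re (z t) = 0" | "finite {t \<in> {0..1}. Re (z t) = 0}"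
    using P.trig_sum_zeros_finite[OF finite_band, of c] unfolding zero_iff by blast
  then show thesis
  proof cases
    case 1
    have "deriv01 (\<lambda>t. arctan (coef_b f \<phi> t / coef_a f \<phi> t)) t = \<psi>' t + residual' t"
      if t: "t \<in> {0..1}" for t
    proof -
      have "((\<lambda>_. 0) has_vector_derivative Re (z' t)) (at t within {0..1})"
        using bounded_linear.has_vector_derivative[OF bounded_linear_Re z_deriv[OF t]] 1 by simp
      then have "Re (z' t) = 0"
        using t vector_derivative_unique_within_closed_interval[of 0 1 t "\<lambda>_. 0" _ 0] by fastforce
      then have "Im (z' t / z t) = 0"
        using 1[of t] by (simp add: Im_divide)
      moreover have "deriv01 (\<lambda>t. arctan (coef_b f \<phi> t / coef_a f \<phi> t)) t = 0"
        using t by (intro deriv01_eqI) (simp_all add: coef_ab_eq 1)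
      ultimately show ?thesis by (simp add: residual'_def)
    qed
    then show thesis by (intro that[of "{}"]) auto
  next
    case 2
    have "deriv01 (\<lambda>t. arctan (coef_b f \<phi> t / coef_a f \<phi> t)) t = \<psi>' t + residual' t"
      if "t \<in> {0..1} - {t \<in> {0..1}. Re (z t) = 0}" for t
    proof -
      have t: "t \<in> {0..1}" "Re (z t) \<noteq> 0" using that by auto
      have "deriv01 (\<lambda>t. arctan (Im (z t) / Re (z t))) t = Im (z' t / z t)"
        by (rule deriv01_eqI[OF arctan_quotient_has_vector_derivative[OF z_deriv[OF t(1)] t(2)] t(1)])
      then show ?thesis by (simp add: coef_ab_eq residual'_def)
    qed
    with 2 show thesis by (rule that)
  qed
qed

section \<open>The full step and the new error\<close>

definition d :: "int \<Rightarrow> complex" where "d = fourier residual'"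

text \<open>Finitely many exceptional points do not change the integral. Since
  \<open>\<psi>'\<close> already lies in the trigonometric space, the projection returns it
  unchanged, and the residual contributes \<open>d\<close>.\<close>

lemma fourier_angle_deriv:
  assumes "k \<in> {- int M..int M}"
  shows "fourier (deriv01 (\<lambda>t. arctan (coef_b f \<phi> t / coef_a f \<phi> t))) k = q k + d k"
proof -
  obtain N where N: "finite N" "\<And>t. t \<in> {0..1} - N \<Longrightarrow>
      deriv01 (\<lambda>t. arctan (coef_b f \<phi> t / coef_a f \<phi> t)) t = \<psi>' t + residual' t"
    using angle_deriv by blast
  have "fourier (deriv01 (\<lambda>t. arctan (coef_b f \<phi> t / coef_a f \<phi> t))) k = fourier (\<lambda>t. \<psi>' t + residual' t) k"
    unfolding fourier_def using N
    by (intro integral_spike[of N]) (auto intro: negligible_finite)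
  also have "\<dots> = fourier \<psi>' k + fourier residual' k"
    unfolding fourier_def of_real_add distrib_right
    by (intro integral_add integrable_continuous_real continuous_intros residual'_cont)
       (auto simp: \<psi>'_def intro!: continuous_on_Re trig_poly_cont continuous_on_of_real)
  also have "fourier \<psi>' k = fourier (deriv01 \<psi>) k"
    unfolding fourier_def
    by (intro integral_cong) (simp add: trig_derivD(3)[OF \<psi>_deriv] \<psi>'_def)
  also have "\<dots> = q k"
    using fourier_deriv01_trig_deriv[OF \<psi>_deriv] assms by simp
  finally show ?thesis by (simp add: d_def)
qed

lemma d_bounds: "d 0 = 0" "coef_sum_norm M d \<le> (2 * real M + 1) * (2 * pi * M * (2 * \<epsilon> / \<mu>))"
  unfolding d_def
  by (rule fourier_derivative_bounded(1)[OF residual_deriv residual'_cont residual_periodic residual_le])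
     (assumption | rule fourier_derivative_bounded(2)[OF residual_deriv residual'_cont residual_periodic residual_le])+

lemma d_real: "Im (trig_poly M d t) = 0"
  unfolding d_def by (rule trig_poly_fourier_real)

lemma phase_incr_deriv_eq: "phase_incr_deriv M f \<phi> t = Re (trig_poly M (\<lambda>k. q k + d k) t)"
  unfolding phase_incr_deriv_def proj_trig_eq trig_poly_def
  by (intro arg_cong[of _ _ Re] sum.cong refl) (simp only: fourier_angle_deriv)

lemma phase_incr_trig_deriv: "trig_deriv M (\<lambda>k. q k + d k) (phase_incr M f \<phi>)"
  unfolding trig_deriv_def
proof (intro ballI conjI)
  fix t :: real assume t: "t \<in> {0..1}"
  show "(phase_incr M f \<phi> has_vector_derivative Re (trig_poly M (\<lambda>k. q k + d k) t)) (at t within {0..1})"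
    unfolding phase_incr_def[abs_def] phase_incr_deriv_eq[abs_def]
    by (rule integral_has_vector_derivative[OF _ t]) (intro continuous_on_Re trig_poly_cont)
  show "Im (trig_poly M (\<lambda>k. q k + d k) t) = 0"
    unfolding trig_poly_add using \<psi>_deriv t d_real by (simp add: trig_deriv_def)
qed

lemma \<theta>_trig_deriv: "trig_deriv M (\<lambda>k. of_real (2 * pi * of_int L) * w k) \<theta>"
proof -
  have "trig_deriv M (\<lambda>k. of_real (2 * pi * of_int L) * w k) (\<lambda>t. 2 * pi * of_int L * \<sigma> t - (- \<theta> 0))"
    by (rule trig_deriv_const_diff[OF trig_deriv_cmult[OF w]])
  then show ?thesis
  proof (rule trig_deriv_cong)
    fix t :: real assume "t \<in> {0..1}"
    from \<theta>_eq[OF this] show "2 * pi * of_int L * \<sigma> t - (- \<theta> 0) = \<theta> t" by linarith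
  qed
qed

text \<open>The increment cancels \<open>- q\<close> in \<open>\<phi>'\<close>, leaving
  \<open>\<theta>'\<close> plus the residual. The factor 1 is written out to match the condition in
  \<open>step_size\<close> at step length 1.\<close>

lemma full_step_trig_deriv:
  "trig_deriv M (\<lambda>k. of_real (2 * pi * of_int L) * w k + d k) (\<lambda>t. \<phi> t + 1 * phase_incr M f \<phi> t)"
proof -
  have "trig_deriv M (\<lambda>k. of_real (2 * pi * of_int L) * w k - q k + (q k + d k))
      (\<lambda>t. (\<theta> t - (\<theta> t - \<phi> t)) + phase_incr M f \<phi> t)"
    by (intro trig_deriv_add[OF _ phase_incr_trig_deriv] trig_deriv_diff \<theta>_trig_deriv q)
  then show ?thesis by simp
qed

text \<open>\<open>\<theta>'\<close> is at least \<open>2 \<pi> L c0\<close>, and by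
  \<open>L_large\<close> the perturbation with coefficients \<open>d\<close> cannot exceed this, so
  the upper end of the range of steps is itself allowed.\<close>

lemma step_size_eq: "step_size M f \<phi> = 1"
  unfolding step_size_def
proof (rule Greatest_equality)
  have "0 \<le> deriv01 (\<lambda>t. \<phi> t + 1 * phase_incr M f \<phi> t) t" if t: "t \<in> {0..1}" for t
  proof -
    have "2 * pi * of_int L * c0 \<le> 2 * pi * of_int L * Re (trig_poly M w t)"
      using c0(2)[OF t] L_pos(1) by (intro mult_left_mono) auto
    moreover have "- Re (trig_poly M d t) \<le> 2 * pi * of_int L * c0"
      using abs_Re_trig_poly_le[of M d t] d_bounds(2) L_large by linarith
    moreover have "deriv01 (\<lambda>t. \<phi> t + 1 * phase_incr M f \<phi> t) t
        = 2 * pi * of_int L * Re (trig_poly M w t) + Re (trig_poly M d t)"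
      unfolding trig_derivD(3)[OF full_step_trig_deriv t] trig_poly_add trig_poly_cmult
      by simp
    ultimately show ?thesis by linarith
  qed
  then show "(1::real) \<in> {0..1} \<and> (\<forall>t\<in>{0..1}. 0 \<le> deriv01 (\<lambda>s. \<phi> s + 1 * phase_incr M f \<phi> s) t)"
    by simp
qed auto

lemma phase_step_error: "trig_deriv M d (\<lambda>t. phase_step M f \<phi> t - \<theta> t)"
proof -
  have "trig_deriv M (\<lambda>k. of_real (2 * pi * of_int L) * w k + d k - of_real (2 * pi * of_int L) * w k)
      (\<lambda>t. \<phi> t + 1 * phase_incr M f \<phi> t - \<theta> t)"
    by (rule trig_deriv_diff[OF full_step_trig_deriv \<theta>_trig_deriv])
  then show ?thesis by (simp add: phase_step_def step_size_eq)
qed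

lemma phase_step_increment: "phase_step M f \<phi> 1 - phase_step M f \<phi> 0 = 2 * pi * of_int L"
proof -
  have i: "((\<lambda>t. Re (trig_poly M d t)) has_integral
      (phase_step M f \<phi> 1 - \<theta> 1) - (phase_step M f \<phi> 0 - \<theta> 0)) {0..1}"
    by (intro fundamental_theorem_of_calculus trig_derivD(1)[OF phase_step_error]) auto
  have "(trig_poly M d has_integral 0) {0..1}"
    using integrable_integral[OF integrable_continuous_real[OF trig_poly_cont[of "{0..1}" M d]]]
      coef_trig_poly[of M d 0] d_bounds(1)
    by (simp add: id_phase.coef_def)
  then have "((\<lambda>t. Re (trig_poly M d t)) has_integral Re 0) {0..1}"
    by (rule has_integral_Re)
  from has_integral_unique[OF i this]
  have "(phase_step M f \<phi> 1 - \<theta> 1) - (phase_step M f \<phi> 0 - \<theta> 0) = 0"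
    by simp
  then show ?thesis
    using \<theta>_eq[of 1] \<sigma>_1 by simp
qed

end

subsection \<open>Contraction of the phase error\<close>

lemma norm_phase_trig_deriv:
  assumes "has_deriv_in_trig_space M \<theta>" "\<forall>t\<in>{0..1}. deriv01 \<theta> t > 0"
    and eq: "\<forall>t\<in>{0..1}. norm_phase \<theta> t = \<sigma> t" and pos: "num_periods \<theta> > 0"
  obtains w where "trig_deriv M w \<sigma>" "\<And>t. t \<in> {0..1} \<Longrightarrow> 0 < Re (trig_poly M w t)"
proof -
  define a where "a = 1 / (2 * pi * num_periods \<theta>)"
  have a: "a > 0" using pos by (simp add: a_def)
  obtain c where c: "trig_deriv M c \<theta>"
    using assms(1) by (auto simp: has_deriv_in_trig_space_iff)
  have "trig_deriv M (\<lambda>k. of_real a * c k) (\<lambda>t. a * (\<theta> t - \<theta> 0))"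
    by (rule trig_deriv_cmult[OF trig_deriv_const_diff[OF c]])
  then have "trig_deriv M (\<lambda>k. of_real a * c k) \<sigma>"
    by (rule trig_deriv_cong) (use eq in \<open>auto simp: norm_phase_def a_def\<close>)
  moreover have "0 < Re (trig_poly M (\<lambda>k. of_real a * c k) t)" if "t \<in> {0..1}" for t
    using bspec[OF assms(2) that] trig_derivD(3)[OF c that] a by (simp add: trig_poly_cmult)
  ultimately show thesis by (rule that)
qed

lemma continuous_positive_lower_bound:
  fixes g :: "real \<Rightarrow> real"
  assumes "continuous_on {0..1} g" "\<And>t. t \<in> {0..1} \<Longrightarrow> 0 < g t"
  obtains m where "0 < m" "\<And>t. t \<in> {0..1} \<Longrightarrow> m \<le> g t"
proof -
  have "\<exists>x\<in>{0..1}. \<forall>y\<in>{0..1}. g x \<le> g y"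
    by (rule continuous_attains_inf[OF _ _ assms(1)]) auto
  then show thesis using that assms(2) by blast
qed

lemma continuous_upper_bound:
  fixes g :: "real \<Rightarrow> real"
  assumes "continuous_on {0..1} g"
  obtains F where "\<And>t. t \<in> {0..1} \<Longrightarrow> \<bar>g t\<bar> \<le> F"
proof -
  have "\<exists>x\<in>{0..1}. \<forall>y\<in>{0..1}. \<bar>g y\<bar> \<le> \<bar>g x\<bar>"
    by (rule continuous_attains_sup[of _ "\<lambda>x. \<bar>g x\<bar>"]) (auto intro: continuous_on_rabs assms)
  then show thesis using that by blast
qed

text \<open>Number of retained frequencies, times the largest factor \<open>2 \<pi> M\<close> of
  differentiation, times the loss \<open>2 / \<mu>\<close> of \<open>residual_le\<close>.\<close>

definition contraction_const :: "nat \<Rightarrow> real \<Rightarrow> real" where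
  "contraction_const M \<mu> = (2 * real M + 1) * (2 * pi * M) * 2 / \<mu>"

text \<open>A sum of nonnegative demands on \<open>L\<close>: the hypotheses of
  \<open>phase_pair\<close> (first three terms), the factor 1/2 (832 is twice 416),
  \<open>\<epsilon> \<le> \<mu> / 2\<close> (576 is four times 144), the full step, and a power term
  of at most 1/2.\<close>

definition threshold :: "nat \<Rightarrow> real \<Rightarrow> real \<Rightarrow> real \<Rightarrow> real \<Rightarrow> real \<Rightarrow> real \<Rightarrow> real \<Rightarrow> real" where
  "threshold M C F \<mu> \<Gamma> c0 E0 B = 8 + E0 + E0 / c0 + 832 * contraction_const M \<mu> * (F + 4 * C) * B
     + 2 * (576 * C + 416 * (F + 4 * C) * B * E0) / \<mu> + contraction_const M \<mu> * \<mu> / c0 + 8 * \<Gamma>"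

lemma phase_err_uminus:
  assumes "trig_deriv M q (\<lambda>t. \<theta> t - \<phi> t)"
  shows "phase_err \<phi> \<theta> = ennreal (coef_sum_norm M q)"
proof -
  have "trig_deriv M (\<lambda>k. of_real (- 1) * q k) (\<lambda>t. (- 1) * (\<theta> t - \<phi> t))"
    by (rule trig_deriv_cmult[OF assms])
  then have "trig_deriv M (\<lambda>k. of_real (- 1) * q k) (\<lambda>t. \<phi> t - \<theta> t)"
    by simp
  from phase_err_trig_deriv[OF this] show ?thesis
    unfolding coef_sum_norm_cmult by simp
qed

text \<open>Invariant of the iteration. \<open>L'\<close> is existential because the initial guess
  may have another number of periods than \<open>\<theta>\<close>.\<close>

definition admissible :: "nat \<Rightarrow> (real \<Rightarrow> real) \<Rightarrow> real \<Rightarrow> (real \<Rightarrow> real) \<Rightarrow> bool" where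
  "admissible M \<theta> E0 \<phi> \<longleftrightarrow> (\<exists>q L'. trig_deriv M q (\<lambda>t. \<theta> t - \<phi> t) \<and>
     \<phi> 1 - \<phi> 0 = 2 * pi * of_int L' \<and> coef_sum_norm M q \<le> E0)"

lemma phase_step_contraction:
  fixes L :: int
  assumes \<sigma>: "trig_deriv M w \<sigma>" "\<sigma> 0 = 0" "\<sigma> 1 = 1"
    and c0: "c0 > 0" "\<And>t. t \<in> {0..1} \<Longrightarrow> c0 \<le> Re (trig_poly M w t)"
    and \<theta>_eq: "\<And>t. t \<in> {0..1} \<Longrightarrow> \<theta> t = \<theta> 0 + 2 * pi * of_int L * \<sigma> t"
    and f0: "continuous_on {0..1} f0" and f1: "continuous_on {0..1} f1"
    and C: "0 < C" and p: "4 \<le> p"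
    and decay: "fast_decay C p \<theta> f0" "fast_decay C p \<theta> f1"
    and F: "\<And>t. t \<in> {0..1} \<Longrightarrow> \<bar>f1 t\<bar> \<le> F"
    and \<mu>: "0 < \<mu>" "\<And>t. t \<in> {0..1} \<Longrightarrow> \<mu> \<le> f1 t"
    and E0_ge: "1 \<le> E0" and \<Gamma>: "\<Gamma> = 144 * contraction_const M \<mu> * C + 1"
    and L: "threshold M C F \<mu> \<Gamma> c0 E0 \<bar>phase_pair.B M w c0 E0\<bar> \<le> of_int L"
    and adm: "admissible M \<theta> E0 \<phi>"
  shows "admissible M \<theta> E0 (phase_step M (signal f0 f1 \<theta>) \<phi>)"
    and "phase_err (phase_step M (signal f0 f1 \<theta>) \<phi>) \<theta>
      \<le> ennreal (\<Gamma> * (of_int L / 4) powr (- p + 2)) + ennreal (1 / 2) * phase_err \<phi> \<theta>"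
proof -
  obtain q L' where adm_q: "trig_deriv M q (\<lambda>t. \<theta> t - \<phi> t)" "\<phi> 1 - \<phi> 0 = 2 * pi * of_int L'"
    "coef_sum_norm M q \<le> E0"
    using adm unfolding admissible_def by blast
  let ?S = "contraction_const M \<mu>" and ?B = "\<bar>phase_pair.B M w c0 E0\<bar>"
  have S: "0 \<le> ?S" using \<mu>(1) by (simp add: contraction_const_def)
  have F0: "0 \<le> F + 4 * C" using F[of 0] C by simp
  have \<Gamma>0: "0 \<le> \<Gamma>" using S C by (simp add: \<Gamma>)
  have nonneg: "0 \<le> E0 / c0" "0 \<le> 832 * ?S * (F + 4 * C) * ?B"
    "0 \<le> 2 * (576 * C + 416 * (F + 4 * C) * ?B * E0) / \<mu>" "0 \<le> ?S * \<mu> / c0"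
    using S F0 C c0(1) \<mu>(1) E0_ge by simp_all
  have Lb: "8 \<le> (of_int L :: real)" "E0 \<le> of_int L" "E0 / c0 \<le> of_int L"
    "832 * ?S * (F + 4 * C) * ?B \<le> of_int L"
    "2 * (576 * C + 416 * (F + 4 * C) * ?B * E0) / \<mu> \<le> of_int L" "?S * \<mu> / c0 \<le> of_int L"
    "8 * \<Gamma> \<le> of_int L"
    using L nonneg E0_ge \<Gamma>0 unfolding threshold_def by linarith+
  have L_pos: "0 < (of_int L :: real)" using Lb(1) by simp
  interpret signal_phase M \<sigma> \<phi> \<theta> w q L L' c0 E0 f0 f1 C p F
  proof unfold_locales
    show "8 \<le> L" using Lb(1) by simp
    show "E0 \<le> c0 * of_int L" using Lb(3) c0(1) by (simp add: pos_divide_le_eq mult.commute)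
  qed (rule \<sigma> c0 \<theta>_eq adm_q Lb(2) f0 f1 C p decay F, assumption?)+
  define x where "x = (of_int L / 4 :: real) powr (- p + 2)"
  define \<epsilon> where "\<epsilon> = 144 * C * x + 416 * (F + 4 * C) * B * E / of_int L"
  \<comment> \<open>\<open>B\<close> is known to be nonnegative only inside the interpretation,
    which itself needs \<open>L\<close> above the threshold; the absolute value in the threshold
    breaks this circle.\<close>
  have B_abs: "?B = B" using B_nonneg by simp
  have x: "0 \<le> x" "x \<le> 4 / of_int L"
  proof -
    have "x \<le> (of_int L / 4) powr (- 1)"
      unfolding x_def using Lb(1) p by (intro powr_mono) auto
    then show "x \<le> 4 / of_int L" using Lb(1) by (simp add: powr_minus_divide)
  qed (simp add: x_def)
  have E_le: "E \<le> E0" using adm_q(3) by (simp add: E_def)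
  have \<epsilon>_le: "\<epsilon> \<le> \<mu> / 2"
  proof -
    have "\<epsilon> \<le> 144 * C * (4 / of_int L) + 416 * (F + 4 * C) * B * E0 / of_int L"
      unfolding \<epsilon>_def using C F0 B_nonneg L_pos x E_le
      by (intro add_mono mult_left_mono divide_right_mono) auto
    also have "\<dots> = (576 * C + 416 * (F + 4 * C) * B * E0) / of_int L"
      by (simp add: add_divide_distrib)
    also have "\<dots> \<le> \<mu> / 2"
      using Lb(5) \<mu>(1) L_pos unfolding B_abs by (simp add: field_simps)
    finally show ?thesis .
  qed
  have S_eq: "(2 * real M + 1) * (2 * pi * M * (2 * e / \<mu>)) = ?S * e" for e
    by (simp add: contraction_const_def)
  interpret small_error M \<sigma> \<phi> \<theta> w q L L' c0 E0 f0 f1 C p F \<mu> \<epsilon>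
  proof unfold_locales
    show "(2 * real M + 1) * (2 * pi * M * (2 * \<epsilon> / \<mu>)) \<le> 2 * pi * of_int L * c0"
    proof -
      have "?S * \<epsilon> \<le> ?S * \<mu>"
        using \<epsilon>_le \<mu>(1) by (intro mult_left_mono S) simp
      also have "\<dots> \<le> 1 * (of_int L * c0)"
        using Lb(6) c0(1) by (simp add: pos_divide_le_eq)
      also have "\<dots> \<le> 2 * pi * (of_int L * c0)"
        using pi_gt3 L_pos c0(1) by (intro mult_right_mono) auto
      finally show ?thesis unfolding S_eq by simp
    qed
  qed (use \<mu> \<epsilon>_le in \<open>simp_all add: \<epsilon>_def x_def\<close>)
  have d_le: "coef_sum_norm M d \<le> \<Gamma> * x + 1 / 2 * E"
  proof -
    have "coef_sum_norm M d \<le> ?S * \<epsilon>"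
      using d_bounds(2) unfolding S_eq .
    also have "\<dots> = 144 * ?S * C * x + 416 * ?S * (F + 4 * C) * B / of_int L * E"
      by (simp add: \<epsilon>_def algebra_simps)
    also have "\<dots> \<le> \<Gamma> * x + 1 / 2 * E"
    proof (intro add_mono mult_right_mono x E_nonneg)
      show "144 * ?S * C \<le> \<Gamma>" by (simp add: \<Gamma>)
      show "416 * ?S * (F + 4 * C) * B / of_int L \<le> 1 / 2"
        using Lb(4) L_pos unfolding B_abs by (simp add: field_simps)
    qed
    finally show ?thesis .
  qed
  have "\<Gamma> * x \<le> 1 / 2"
  proof -
    have "\<Gamma> * x \<le> \<Gamma> * (4 / of_int L)"
      using x(2) \<Gamma>0 by (rule mult_left_mono)
    also have "\<dots> \<le> 1 / 2" using Lb(7) L_pos by (simp add: field_simps)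
    finally show ?thesis .
  qed
  \<comment> \<open>Closes the invariant: \<open>1/2 + E0 / 2 \<le> E0\<close> because
    \<open>E0 \<ge> 1\<close>.\<close>
  with d_le E_le E0_ge have d_le_E0: "coef_sum_norm M d \<le> E0" by linarith
  have "trig_deriv M (\<lambda>k. of_real (- 1) * d k) (\<lambda>t. (- 1) * (phase_step M f \<phi> t - \<theta> t))"
    by (rule trig_deriv_cmult[OF phase_step_error])
  then have step: "trig_deriv M (\<lambda>k. of_real (- 1) * d k) (\<lambda>t. \<theta> t - phase_step M f \<phi> t)"
    by simp
  have "coef_sum_norm M (\<lambda>k. of_real (- 1) * d k) \<le> E0"
    unfolding coef_sum_norm_cmult using d_le_E0 by simp
  with step phase_step_increment show "admissible M \<theta> E0 (phase_step M f \<phi>)"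
    unfolding admissible_def by blast
  have "phase_err (phase_step M f \<phi>) \<theta> \<le> ennreal (\<Gamma> * x + 1 / 2 * E)"
    unfolding phase_err_trig_deriv[OF phase_step_error] using d_le by (rule ennreal_leI)
  also have "\<dots> = ennreal (\<Gamma> * x) + ennreal (1 / 2) * ennreal E"
    using \<Gamma>0 x(1) E_nonneg
    by (subst ennreal_mult[symmetric]) (simp_all only: ennreal_plus mult_nonneg_nonneg divide_nonneg_nonneg zero_le_one zero_le_numeral)
  also have "ennreal E = phase_err \<phi> \<theta>"
    unfolding phase_err_uminus[OF adm_q(1)] E_def ..
  finally show "phase_err (phase_step M f \<phi>) \<theta>
      \<le> ennreal (\<Gamma> * (of_int L / 4) powr (- p + 2)) + ennreal (1 / 2) * phase_err \<phi> \<theta>"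
    by (simp only: x_def)
qed

text \<open>\<open>\<Gamma>0\<close> is chosen before the normalised phase and cannot depend on it,
  while \<open>\<eta>0\<close> may: how small the derivative of \<open>\<theta>bar\<close> gets and
  how large its coefficients are decide how many periods are needed. Whole numbers of periods
  express periodicity in the phase coordinates.\<close>

theorem theorem2p2:
  fixes C0 p :: real and M0 :: nat and f1 :: "real \<Rightarrow> real"
  assumes "C0 > 0" and "p \<ge> 4"
    and "continuous_on {0..1} f1" and "\<forall>t\<in>{0..1}. f1 t > 0"
  shows "\<exists>\<Gamma>0 :: real. \<Gamma>0 > 0 \<and> (\<forall>\<theta>bar :: real \<Rightarrow> real. \<exists>\<eta>0 :: real. \<eta>0 > 4 \<and>
    (\<forall>(f0 :: real \<Rightarrow> real) (\<theta> :: real \<Rightarrow> real) (\<theta>0 :: real \<Rightarrow> real).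
      continuous_on {0..1} f0 \<longrightarrow>
      has_deriv_in_trig_space M0 \<theta> \<longrightarrow>
      (\<forall>t\<in>{0..1}. deriv01 \<theta> t > 0) \<longrightarrow>
      (\<forall>t\<in>{0..1}. norm_phase \<theta> t = \<theta>bar t) \<longrightarrow>
      signal f0 f1 \<theta> 0 = signal f0 f1 \<theta> 1 \<longrightarrow>
      num_periods \<theta> \<in> \<int> \<longrightarrow>
      fast_decay C0 p \<theta> f0 \<longrightarrow>
      fast_decay C0 p \<theta> f1 \<longrightarrow>
      num_periods \<theta> > \<eta>0 \<longrightarrow>
      has_deriv_in_trig_space M0 \<theta>0 \<longrightarrow>
      num_periods \<theta>0 \<in> \<int> \<longrightarrow>
      phase_err \<theta>0 \<theta> \<le> ennreal (pi * real M0 / 2) \<longrightarrow>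
      (\<forall>m. phase_err (phase_iter M0 (signal f0 f1 \<theta>) \<theta>0 (Suc m)) \<theta>
         \<le> ennreal (\<Gamma>0 * (num_periods \<theta> / 4) powr (- p + 2))
            + ennreal (1 / 2) * phase_err (phase_iter M0 (signal f0 f1 \<theta>) \<theta>0 m) \<theta>)))"
proof -
  obtain \<mu> where \<mu>: "0 < \<mu>" "\<And>t. t \<in> {0..1} \<Longrightarrow> \<mu> \<le> f1 t"
    using continuous_positive_lower_bound[OF assms(3)] assms(4) by blast
  obtain F where F: "\<And>t. t \<in> {0..1} \<Longrightarrow> \<bar>f1 t\<bar> \<le> F"
    using continuous_upper_bound[OF assms(3)] by blast
  define \<Gamma>0 where "\<Gamma>0 = 144 * contraction_const M0 \<mu> * C0 + 1"
  \<comment> \<open>The summand 1 secures \<open>E0 \<ge> 1\<close> also for \<open>M0 = 0\<close>,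
    as the invariant requires.\<close>
  define E0 where "E0 = pi * real M0 / 2 + 1"
  have \<Gamma>0: "\<Gamma>0 > 0"
    using \<mu>(1) assms(1) by (simp add: \<Gamma>0_def contraction_const_def add_nonneg_pos)
  have E0: "1 \<le> E0" by (simp add: E0_def)
  show ?thesis
  proof (rule exI[of _ \<Gamma>0], intro conjI \<Gamma>0 allI)
    fix \<theta>bar :: "real \<Rightarrow> real"
    let ?Q = "\<lambda>w. trig_deriv M0 w \<theta>bar \<and> (\<forall>t\<in>{0..1}. 0 < Re (trig_poly M0 w t))"
    \<comment> \<open>\<open>\<eta>0\<close> is fixed before any signal is given, and
      \<open>\<theta>bar\<close> is arbitrary here. So \<open>w\<close> consists of suitable
      coefficients if there are any, and \<open>c0\<close> below is just some positive number
      otherwise.\<close>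
    obtain w where w: "?Q w' \<Longrightarrow> ?Q w" for w'
      by blast
    have "\<exists>c0>0. ?Q w \<longrightarrow> (\<forall>t\<in>{0..1}. c0 \<le> Re (trig_poly M0 w t))"
    proof (cases "?Q w")
      case True
      have "continuous_on {0..1} (\<lambda>t. Re (trig_poly M0 w t))"
        by (intro continuous_on_Re trig_poly_cont)
      from continuous_positive_lower_bound[OF this] True show ?thesis
        by metis
    qed (auto intro: zero_less_one)
    then obtain c0 where c0: "0 < c0" "?Q w \<Longrightarrow> t \<in> {0..1} \<Longrightarrow> c0 \<le> Re (trig_poly M0 w t)" for t
      by blast
    define T where "T = threshold M0 C0 F \<mu> \<Gamma>0 c0 E0 \<bar>phase_pair.B M0 w c0 E0\<bar>"
    show "\<exists>\<eta>0>4. \<forall>f0 \<theta> \<theta>0.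
      continuous_on {0..1} f0 \<longrightarrow>
      has_deriv_in_trig_space M0 \<theta> \<longrightarrow>
      (\<forall>t\<in>{0..1}. deriv01 \<theta> t > 0) \<longrightarrow>
      (\<forall>t\<in>{0..1}. norm_phase \<theta> t = \<theta>bar t) \<longrightarrow>
      signal f0 f1 \<theta> 0 = signal f0 f1 \<theta> 1 \<longrightarrow>
      num_periods \<theta> \<in> \<int> \<longrightarrow>
      fast_decay C0 p \<theta> f0 \<longrightarrow>
      fast_decay C0 p \<theta> f1 \<longrightarrow>
      num_periods \<theta> > \<eta>0 \<longrightarrow>
      has_deriv_in_trig_space M0 \<theta>0 \<longrightarrow>
      num_periods \<theta>0 \<in> \<int> \<longrightarrow>
      phase_err \<theta>0 \<theta> \<le> ennreal (pi * real M0 / 2) \<longrightarrow>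
      (\<forall>m. phase_err (phase_iter M0 (signal f0 f1 \<theta>) \<theta>0 (Suc m)) \<theta>
         \<le> ennreal (\<Gamma>0 * (num_periods \<theta> / 4) powr (- p + 2))
            + ennreal (1 / 2) * phase_err (phase_iter M0 (signal f0 f1 \<theta>) \<theta>0 m) \<theta>)"
    \<comment> \<open>The 5 secures \<open>\<eta>0 > 4\<close>; the contraction rests on
      \<open>T\<close>.\<close>
    proof (intro exI[of _ "max 5 T"] conjI allI impI)
      show "4 < max 5 T" by simp
      fix f0 \<theta> \<theta>0 :: "real \<Rightarrow> real" and m :: nat
      assume f0: "continuous_on {0..1} f0" and \<theta>: "has_deriv_in_trig_space M0 \<theta>"
        "\<forall>t\<in>{0..1}. deriv01 \<theta> t > 0" "\<forall>t\<in>{0..1}. norm_phase \<theta> t = \<theta>bar t"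
        and int: "num_periods \<theta> \<in> \<int>" and decay: "fast_decay C0 p \<theta> f0" "fast_decay C0 p \<theta> f1"
        and large: "num_periods \<theta> > max 5 T"
        and \<theta>0: "has_deriv_in_trig_space M0 \<theta>0" "num_periods \<theta>0 \<in> \<int>"
        "phase_err \<theta>0 \<theta> \<le> ennreal (pi * real M0 / 2)"
      have pos: "num_periods \<theta> > 0" using large by simp
      obtain L where L: "num_periods \<theta> = of_int L" using int by (rule Ints_cases)
      have "?Q w"
      proof (rule norm_phase_trig_deriv[OF \<theta> pos])
        fix w' assume "trig_deriv M0 w' \<theta>bar" "\<And>t. t \<in> {0..1} \<Longrightarrow> 0 < Re (trig_poly M0 w' t)"
        then show "?Q w" by (intro w) blast
      qed
      have bounds: "\<theta>bar 0 = 0" "\<theta>bar 1 = 1"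
        using bspec[OF \<theta>(3), of 0] bspec[OF \<theta>(3), of 1] pos
        by (auto simp: norm_phase_def num_periods_def zero_less_divide_iff split: if_splits)
      have \<theta>_eq: "\<theta> t = \<theta> 0 + 2 * pi * of_int L * \<theta>bar t" if "t \<in> {0..1}" for t
        using bspec[OF \<theta>(3) that, symmetric] pos L by (simp add: norm_phase_def)
      have TL: "T \<le> of_int L" using large L by simp
      note contraction = phase_step_contraction[OF conjunct1[OF \<open>?Q w\<close>] bounds c0(1) c0(2)[OF \<open>?Q w\<close>] \<theta>_eq
          f0 assms(3,1,2) decay F \<mu> E0 \<Gamma>0_def TL[unfolded T_def]]
      have step: "admissible M0 \<theta> E0 (phase_step M0 (signal f0 f1 \<theta>) \<phi>)"
        "phase_err (phase_step M0 (signal f0 f1 \<theta>) \<phi>) \<theta>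
          \<le> ennreal (\<Gamma>0 * (of_int L / 4) powr (- p + 2)) + ennreal (1 / 2) * phase_err \<phi> \<theta>"
        if "admissible M0 \<theta> E0 \<phi>" for \<phi>
        by (rule contraction[rotated 4, OF that], assumption+)+
      have "admissible M0 \<theta> E0 \<theta>0"
      proof -
        obtain c c' where "trig_deriv M0 c \<theta>" "trig_deriv M0 c' \<theta>0"
          using \<theta>(1) \<theta>0(1) by (auto simp: has_deriv_in_trig_space_iff)
        then have q: "trig_deriv M0 (\<lambda>k. c k - c' k) (\<lambda>t. \<theta> t - \<theta>0 t)"
          by (rule trig_deriv_diff)
        obtain L' where "num_periods \<theta>0 = of_int L'" using \<theta>0(2) by (rule Ints_cases)
        then have "\<theta>0 1 - \<theta>0 0 = 2 * pi * of_int L'"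
          by (simp add: num_periods_def field_simps)
        moreover have "coef_sum_norm M0 (\<lambda>k. c k - c' k) \<le> pi * real M0 / 2"
          using \<theta>0(3) unfolding phase_err_uminus[OF q] by (simp add: ennreal_le_iff)
        ultimately show ?thesis
          using q unfolding admissible_def E0_def by fastforce
      qed
      then have "admissible M0 \<theta> E0 (phase_iter M0 (signal f0 f1 \<theta>) \<theta>0 m)"
        by (induction m) (auto intro: step(1))
      from step(2)[OF this] show "phase_err (phase_iter M0 (signal f0 f1 \<theta>) \<theta>0 (Suc m)) \<theta>
         \<le> ennreal (\<Gamma>0 * (num_periods \<theta> / 4) powr (- p + 2))
            + ennreal (1 / 2) * phase_err (phase_iter M0 (signal f0 f1 \<theta>) \<theta>0 m) \<theta>"
        by (simp only: phase_iter.simps L)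
    qed
  qed
qed

end
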